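(* Suppose that the uniform conditional mixing assumption $$\lim_{M\to\infty}\limsup_{N\to\infty}\bigg\|\frac1N\sum_{k=1}^N\mathop{\mathrm{ess\,sup}}_{u,u'\in\mathbb{U}_0}\big|\mathbf{E}[\{\bar\ell_0^M(u)\circ T^{-k}\}\,\bar\ell_0^M(u')|\mathcal{Y}_{-\infty,0}]\big|\bigg\|_1=0$$ holds. Then the mean-optimal strategy $\mathbf{\tilde u}$ is weakly pathwise optimal, that is, for every admissible strategy $\mathbf{u}$ and every $\varepsilon>0$, $\mathbf{P}[L_N(\mathbf{u})-L_N(\mathbf{\tilde u})\ge-\varepsilon]\to1$ as $N\to\infty$; and the optimal long time-average loss satisfies the ergodic theorem $L_N(\mathbf{\tilde u})\to L^\star$ in $L^1$ as $N\to\infty$, where $$L^\star:=\mathbf{E}\Big[\mathop{\mathrm{ess\,inf}}_{u\in\mathbb{U}_0}\mathbf{E}[\ell_0(u)|\mathcal{Y}_{-\infty,0}]\Big].$$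
   Context: Setting: $(\Omega,\mathcal{B},\mathbf{P})$ is a probability space, $\mathcal{Y}\subseteq\mathcal{B}$ a sub-$\sigma$-field, $T:\Omega\to\Omega$ an invertible (bimeasurable) measure-preserving ergodic transformation, $(U,\mathcal{U})$ a measurable space of decisions. For a $\sigma$-field $\mathcal{A}$ and $k\in\mathbb{Z}$, $T^k\mathcal{A}=\{T^kA:A\in\mathcal{A}\}$. For $-\infty\le m\le n\le\infty$, $\mathcal{Y}_{m,n}=\bigvee_{k=m}^n T^{-k}\mathcal{Y}$. For $m\le n$, $\mathbb{U}_{m,n}$ is the set of $\mathcal{Y}_{m,n}$-measurable maps $u:\Omega\to U$, and $\mathbb{U}_n=\bigcup_{-\infty<m\le n}\mathbb{U}_{m,n}$. Loss: $\ell:U\times\Omega\to\mathbb{R}$ is measurable and $|\ell(u,\omega)|\le\Lambda(\omega)$ for all $(u,\omega)$ with $\Lambda\in L^1(\mathbf{P})$. For $n\in\mathbb{Z}$, $\ell_n(u)(\omega)=\ell(u,T^n\omega)$; for a random decision $u:\Omega\to U$, $\ell_n(u)(\omega)=\ell(u(\omega),T^n\omega)$. For $u\in\mathbb{U}_0$ and $M>0$, $$\bar\ell_0^M(u):=\ell_0(u)\mathbf{1}_{\Lambda\le M}-\mathbf{E}[\ell_0(u)\mathbf{1}_{\Lambda\le M}|\mathcal{Y}_{-\infty,0}],$$ a random variable; $\bar\ell_0^M(u)\circ T^{-k}$ is its composition with $T^{-k}$ (so $u$ is also evaluated at $T^{-k}\omega$). A strategy $\mathbf{u}=(u_k)_{k\ge1}$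 is admissible if $u_k\in\mathbb{U}_{0,k}$ for every $k\ge 1$. Its time-average loss over horizon $N$ is $L_N(\mathbf{u})=\frac1N\sum_{k=1}^N\ell_k(u_k)$. Mean-optimal strategy: $\mathbf{\tilde u}=(\tilde u_k)_{k\ge1}$ denotes an (arbitrary, fixed) admissible strategy such that for every $k\ge1$, $\mathbf{E}[\ell_k(\tilde u_k)|\mathcal{Y}_{0,k}]\le \mathop{\mathrm{ess\,inf}}_{u\in\mathbb{U}_{0,k}}\mathbf{E}[\ell_k(u)|\mathcal{Y}_{0,k}]+k^{-1}$ a.s. (such a strategy always exists). *)

theory Defs
  imports "HOL-Probability.Probability"
begin

section \<open>Essential supremum and infimum of a family of random variables\<close>

text \<open>
  The constant \<open>esssup\<close> of the library is the essential supremum of a single function. Here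
  we need the least upper bound of a possibly uncountable family \<open>F\<close> with respect to the
  almost sure order. It is determined up to null sets only, so \<open>ess_Sup\<close> and \<open>ess_Inf\<close>
  select a version; existence is shown below.
\<close>

definition is_ess_Sup :: "'a measure \<Rightarrow> ('a \<Rightarrow> ereal) set \<Rightarrow> ('a \<Rightarrow> ereal) \<Rightarrow> bool" where
  "is_ess_Sup M F g \<longleftrightarrow>
     g \<in> borel_measurable M \<and>
     (\<forall>f\<in>F. AE x in M. f x \<le> g x) \<and>
     (\<forall>h\<in>borel_measurable M. (\<forall>f\<in>F. AE x in M. f x \<le> h x) \<longrightarrow> (AE x in M. g x \<le> h x))"

definition is_ess_Inf :: "'a measure \<Rightarrow> ('a \<Rightarrow> ereal) set \<Rightarrow> ('a \<Rightarrow> ereal) \<Rightarrow> bool" where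
  "is_ess_Inf M F g \<longleftrightarrow>
     g \<in> borel_measurable M \<and>
     (\<forall>f\<in>F. AE x in M. g x \<le> f x) \<and>
     (\<forall>h\<in>borel_measurable M. (\<forall>f\<in>F. AE x in M. h x \<le> f x) \<longrightarrow> (AE x in M. h x \<le> g x))"

definition ess_Sup :: "'a measure \<Rightarrow> ('a \<Rightarrow> ereal) set \<Rightarrow> 'a \<Rightarrow> ereal" where
  "ess_Sup M F = (SOME g. is_ess_Sup M F g)"

definition ess_Inf :: "'a measure \<Rightarrow> ('a \<Rightarrow> ereal) set \<Rightarrow> 'a \<Rightarrow> ereal" where
  "ess_Inf M F = (SOME g. is_ess_Inf M F g)"

text \<open>A bounded strictly increasing function on the extended reals, used to prove existence.\<close>

definition ereal_arctan :: "ereal \<Rightarrow> real" where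
  "ereal_arctan x =
     (if x = \<infinity> then pi / 2 else if x = -\<infinity> then - pi / 2 else arctan (real_of_ereal x))"

lemma ereal_arctan_less: "x < y \<Longrightarrow> ereal_arctan x < ereal_arctan y"
  using arctan_lbound arctan_ubound pi_gt_zero
  by (cases x; cases y) (auto simp: ereal_arctan_def arctan_less_iff)

lemma ereal_arctan_mono: "x \<le> y \<Longrightarrow> ereal_arctan x \<le> ereal_arctan y"
  using ereal_arctan_less[of x y] by (cases "x = y") (auto simp: le_less)

lemma ereal_arctan_bound: "\<bar>ereal_arctan x\<bar> \<le> pi / 2"
  using arctan_lbound[of "real_of_ereal x"] arctan_ubound[of "real_of_ereal x"] pi_gt_zero
  by (auto simp: ereal_arctan_def abs_le_iff)

lemma ereal_arctan_measurable [measurable]: "ereal_arctan \<in> borel_measurable borel"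
  unfolding ereal_arctan_def by measurable

lemma (in finite_measure) ex_ess_Sup:
  assumes F: "F \<subseteq> borel_measurable M"
  shows "\<exists>g. is_ess_Sup M F g"
proof -
  define I where "I C = (\<integral>x. ereal_arctan (SUP f\<in>C. f x) \<partial>M)" for C :: "('a \<Rightarrow> ereal) set"
  define \<C> where "\<C> = {C. C \<subseteq> F \<and> countable C}"
  have meas: "(\<lambda>x. SUP f\<in>C. f x) \<in> borel_measurable M" if "C \<in> \<C>" for C
    using that F by (intro borel_measurable_SUP) (auto simp: \<C>_def)
  have int: "integrable M (\<lambda>x. ereal_arctan (SUP f\<in>C. f x))" if "C \<in> \<C>" for C
  proof (rule integrable_const_bound)
    show "AE x in M. norm (ereal_arctan (SUP f\<in>C. f x)) \<le> pi / 2"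
      using ereal_arctan_bound by simp
    show "(\<lambda>x. ereal_arctan (SUP f\<in>C. f x)) \<in> borel_measurable M"
      using meas[OF that] by measurable
  qed
  have I_mono: "I C \<le> I D" if "C \<in> \<C>" "D \<in> \<C>" "C \<subseteq> D" for C D
    unfolding I_def using that by (intro integral_mono int ereal_arctan_mono SUP_subset_mono) auto
  have bdd: "bdd_above (I ` \<C>)"
  proof (rule bdd_aboveI2)
    fix C assume C: "C \<in> \<C>"
    have "I C \<le> (\<integral>x. pi / 2 \<partial>M)"
      unfolding I_def using abs_le_D1[OF ereal_arctan_bound] by (intro integral_mono int C) auto
    then show "I C \<le> (\<integral>x. pi / 2 \<partial>M)" .
  qed
  have ne: "\<C> \<noteq> {}"
    by (auto simp: \<C>_def intro!: exI[of _ "{}"])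
  define s where "s = (SUP C\<in>\<C>. I C)"
  have "\<exists>C\<in>\<C>. s - 1 / real (Suc n) < I C" for n
    using less_cSUP_iff[OF ne bdd, of "s - 1 / real (Suc n)"] by (auto simp: s_def)
  then obtain c where c: "\<And>n. c n \<in> \<C>" "\<And>n. s - 1 / real (Suc n) < I (c n)"
    by metis
  define D where "D = (\<Union>n. c n)"
  have D: "D \<in> \<C>"
    using c(1) unfolding D_def \<C>_def by auto
  have "s - 1 / real (Suc n) \<le> I D" for n
    using order.trans[OF less_imp_le[OF c(2)[of n]] I_mono[OF c(1)[of n] D]]
    by (auto simp: D_def)
  moreover have "(\<lambda>n. s - 1 / real (Suc n)) \<longlonglongrightarrow> s - 0"
    by (intro tendsto_diff tendsto_const LIMSEQ_Suc lim_1_over_n)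
  ultimately have s_le: "s \<le> I D"
    by (intro LIMSEQ_le_const2[of "\<lambda>n. s - 1 / real (Suc n)"]) auto
  define g where "g x = (SUP f\<in>D. f x)" for x
  have upper: "AE x in M. f x \<le> g x" if "f \<in> F" for f
  proof -
    have D': "insert f D \<in> \<C>"
      using D that by (auto simp: \<C>_def)
    have "I (insert f D) \<le> I D"
      using cSUP_upper[OF D' bdd] s_le by (simp add: s_def)
    then have eq: "I D = I (insert f D)"
      using I_mono[OF D D'] by auto
    have "AE x in M. ereal_arctan (SUP f\<in>D. f x) = ereal_arctan (SUP f\<in>insert f D. f x)"
      by (rule integral_ineq_eq_0_then_AE[OF _ int[OF D] int[OF D'] eq[unfolded I_def]])
         (auto intro!: AE_I2 ereal_arctan_mono SUP_subset_mono)
    then show ?thesis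
    proof eventually_elim
      case (elim x)
      then have "\<not> (SUP f\<in>D. f x) < (SUP f\<in>insert f D. f x)"
        using ereal_arctan_less by fastforce
      then show ?case
        by (auto simp: g_def not_less)
    qed
  qed
  have least: "AE x in M. g x \<le> h x" if "\<forall>f\<in>F. AE x in M. f x \<le> h x" for h
  proof -
    have "AE x in M. \<forall>f\<in>D. f x \<le> h x"
      using D that by (subst AE_ball_countable) (auto simp: \<C>_def)
    then show ?thesis
      by eventually_elim (auto simp: g_def intro: SUP_least)
  qed
  show ?thesis
    using meas[OF D] upper least unfolding is_ess_Sup_def g_def by blast
qed

lemma is_ess_Inf_uminus:
  assumes "is_ess_Sup M ((\<lambda>f x. - f x) ` F) g"
  shows "is_ess_Inf M F (\<lambda>x. - g x)"
  unfolding is_ess_Inf_def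
proof (intro conjI ballI impI)
  show "(\<lambda>x. - g x) \<in> borel_measurable M"
    using assms by (auto simp: is_ess_Sup_def)
next
  fix f assume "f \<in> F"
  then have "AE x in M. - f x \<le> g x"
    using assms by (auto simp: is_ess_Sup_def)
  then show "AE x in M. - g x \<le> f x"
    by eventually_elim (simp add: ereal_uminus_le_reorder)
next
  fix h :: "'a \<Rightarrow> ereal"
  assume h: "h \<in> borel_measurable M" "\<forall>f\<in>F. AE x in M. h x \<le> f x"
  then have "\<forall>f\<in>(\<lambda>f x. - f x) ` F. AE x in M. f x \<le> - h x"
    by auto
  then have "AE x in M. g x \<le> - h x"
    using assms h(1) unfolding is_ess_Sup_def by (metis borel_measurable_uminus_ereal)
  then show "AE x in M. h x \<le> - g x"
    by eventually_elim (metis ereal_minus_le_minus ereal_uminus_uminus)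
qed

lemma (in finite_measure) ex_ess_Inf:
  assumes "F \<subseteq> borel_measurable M"
  shows "\<exists>g. is_ess_Inf M F g"
proof -
  have "(\<lambda>f x. - f x) ` F \<subseteq> borel_measurable M"
    using assms by auto
  from ex_ess_Sup[OF this] show ?thesis
    using is_ess_Inf_uminus by blast
qed

lemma (in finite_measure) is_ess_Sup_ess_Sup:
  "F \<subseteq> borel_measurable M \<Longrightarrow> is_ess_Sup M F (ess_Sup M F)"
  unfolding ess_Sup_def by (rule someI_ex[OF ex_ess_Sup])

lemma (in finite_measure) is_ess_Inf_ess_Inf:
  "F \<subseteq> borel_measurable M \<Longrightarrow> is_ess_Inf M F (ess_Inf M F)"
  unfolding ess_Inf_def by (rule someI_ex[OF ex_ess_Inf])


section \<open>The dynamical system\<close>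

definition ergodic_automorphism :: "'a measure \<Rightarrow> ('a \<Rightarrow> 'a) \<Rightarrow> bool" where
  "ergodic_automorphism M T \<longleftrightarrow>
     bij_betw T (space M) (space M) \<and>
     T \<in> M \<rightarrow>\<^sub>M M \<and>
     inv_into (space M) T \<in> M \<rightarrow>\<^sub>M M \<and>
     distr M M T = M \<and>
     (\<forall>A\<in>sets M. T -` A \<inter> space M = A \<longrightarrow> measure M A = 0 \<or> measure M A = 1)"

definition tpow :: "'a measure \<Rightarrow> ('a \<Rightarrow> 'a) \<Rightarrow> int \<Rightarrow> 'a \<Rightarrow> 'a" where
  "tpow M T k = (if 0 \<le> k then T ^^ nat k else inv_into (space M) T ^^ nat (- k))"

text \<open>
  For a set of times \<open>K\<close>, \<open>obs M Y T K\<close> is the join over \<open>k \<in> K\<close> of the \<open>\<sigma>\<close>-fields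
  \<open>T\<^sup>-\<^sup>k Y = {T\<^sup>-\<^sup>k A | A \<in> Y}\<close>, as a measurable space on \<open>space M\<close>. Thus
  \<open>Y\<^sub>m\<^sub>,\<^sub>n\<close> is \<open>obs M Y T {m..n}\<close> and \<open>Y\<^sub>-\<^sub>\<infinity>\<^sub>,\<^sub>n\<close> is \<open>obs M Y T {..n}\<close>.
\<close>

definition obs :: "'a measure \<Rightarrow> 'a measure \<Rightarrow> ('a \<Rightarrow> 'a) \<Rightarrow> int set \<Rightarrow> 'a measure" where
  "obs M Y T K = sigma (space M) (\<Union>k\<in>K. (\<lambda>A. tpow M T (- k) ` A) ` sets Y)"

section \<open>Decisions and losses\<close>

definition decisions ::
    "'a measure \<Rightarrow> 'a measure \<Rightarrow> ('a \<Rightarrow> 'a) \<Rightarrow> 'u measure \<Rightarrow> int \<Rightarrow> int \<Rightarrow> ('a \<Rightarrow> 'u) set" where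
  "decisions M Y T U m n = obs M Y T {m..n} \<rightarrow>\<^sub>M U"

definition decisions_upto ::
    "'a measure \<Rightarrow> 'a measure \<Rightarrow> ('a \<Rightarrow> 'a) \<Rightarrow> 'u measure \<Rightarrow> int \<Rightarrow> ('a \<Rightarrow> 'u) set" where
  "decisions_upto M Y T U n = (\<Union>m\<in>{..n}. decisions M Y T U m n)"

definition loss ::
    "'a measure \<Rightarrow> ('a \<Rightarrow> 'a) \<Rightarrow> ('u \<Rightarrow> 'a \<Rightarrow> real) \<Rightarrow> int \<Rightarrow> ('a \<Rightarrow> 'u) \<Rightarrow> 'a \<Rightarrow> real" where
  "loss M T l n u \<omega> = l (u \<omega>) (tpow M T n \<omega>)"

definition centered_loss ::
    "'a measure \<Rightarrow> 'a measure \<Rightarrow> ('a \<Rightarrow> 'a) \<Rightarrow> ('u \<Rightarrow> 'a \<Rightarrow> real) \<Rightarrow> ('a \<Rightarrow> real) \<Rightarrow> real \<Rightarrow>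
     ('a \<Rightarrow> 'u) \<Rightarrow> 'a \<Rightarrow> real" where
  "centered_loss M Y T l \<Lambda> B u \<omega> =
     loss M T l 0 u \<omega> * indicator {\<omega>. \<Lambda> \<omega> \<le> B} \<omega>
     - real_cond_exp M (obs M Y T {..0})
         (\<lambda>\<omega>. loss M T l 0 u \<omega> * indicator {\<omega>. \<Lambda> \<omega> \<le> B} \<omega>) \<omega>"

text \<open>
  Strategies are sequences indexed by \<open>k \<ge> 1\<close>; the value at index 0 is never used.
\<close>

definition admissible ::
    "'a measure \<Rightarrow> 'a measure \<Rightarrow> ('a \<Rightarrow> 'a) \<Rightarrow> 'u measure \<Rightarrow> (nat \<Rightarrow> 'a \<Rightarrow> 'u) \<Rightarrow> bool" where
  "admissible M Y T U u \<longleftrightarrow> (\<forall>k\<ge>1. u k \<in> decisions M Y T U 0 (int k))"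

definition avg_loss ::
    "'a measure \<Rightarrow> ('a \<Rightarrow> 'a) \<Rightarrow> ('u \<Rightarrow> 'a \<Rightarrow> real) \<Rightarrow> nat \<Rightarrow> (nat \<Rightarrow> 'a \<Rightarrow> 'u) \<Rightarrow> 'a \<Rightarrow> real" where
  "avg_loss M T l N u \<omega> = 1 / real N * (\<Sum>k=1..N. loss M T l (int k) (u k) \<omega>)"

definition mean_optimal ::
    "'a measure \<Rightarrow> 'a measure \<Rightarrow> ('a \<Rightarrow> 'a) \<Rightarrow> 'u measure \<Rightarrow> ('u \<Rightarrow> 'a \<Rightarrow> real) \<Rightarrow>
     (nat \<Rightarrow> 'a \<Rightarrow> 'u) \<Rightarrow> bool" where
  "mean_optimal M Y T U l v \<longleftrightarrow>
     admissible M Y T U v \<and>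
     (\<forall>k\<ge>1. AE \<omega> in M.
        ereal (real_cond_exp M (obs M Y T {0..int k}) (loss M T l (int k) (v k)) \<omega>)
        \<le> ess_Inf M
             {\<lambda>\<omega>. ereal (real_cond_exp M (obs M Y T {0..int k}) (loss M T l (int k) u) \<omega>) | u.
                u \<in> decisions M Y T U 0 (int k)} \<omega>
           + ereal (1 / real k))"

definition weakly_pathwise_optimal ::
    "'a measure \<Rightarrow> 'a measure \<Rightarrow> ('a \<Rightarrow> 'a) \<Rightarrow> 'u measure \<Rightarrow> ('u \<Rightarrow> 'a \<Rightarrow> real) \<Rightarrow>
     (nat \<Rightarrow> 'a \<Rightarrow> 'u) \<Rightarrow> bool" where
  "weakly_pathwise_optimal M Y T U l v \<longleftrightarrow>
     (\<forall>u. admissible M Y T U u \<longrightarrow> (\<forall>\<epsilon>>0.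
        (\<lambda>N. measure M {\<omega>\<in>space M. avg_loss M T l N u \<omega> - avg_loss M T l N v \<omega> \<ge> - \<epsilon>})
          \<longlonglongrightarrow> 1))"

text \<open>
  The \<open>L\<^sup>1\<close> norm is taken in \<open>[0, \<infinity>]\<close>, so that no integrability or finiteness is
  presupposed.
\<close>

definition uniform_conditional_mixing ::
    "'a measure \<Rightarrow> 'a measure \<Rightarrow> ('a \<Rightarrow> 'a) \<Rightarrow> 'u measure \<Rightarrow> ('u \<Rightarrow> 'a \<Rightarrow> real) \<Rightarrow>
     ('a \<Rightarrow> real) \<Rightarrow> bool" where
  "uniform_conditional_mixing M Y T U l \<Lambda> \<longleftrightarrow>
     ((\<lambda>B::real. limsup (\<lambda>N::nat.
        \<integral>\<^sup>+\<omega>. e2ennreal \<bar>ereal (1 / real N) * (\<Sum>k=1..N.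
           ess_Sup M
             {\<lambda>\<omega>. ereal \<bar>real_cond_exp M (obs M Y T {..0})
                  (\<lambda>\<omega>. centered_loss M Y T l \<Lambda> B u (tpow M T (- int k) \<omega>)
                       * centered_loss M Y T l \<Lambda> B u' \<omega>) \<omega>\<bar> | u u'.
                u \<in> decisions_upto M Y T U 0 \<and> u' \<in> decisions_upto M Y T U 0} \<omega>)\<bar> \<partial>M))
      \<longlongrightarrow> 0) at_top"

text \<open>
  The essential infimum below is almost surely finite in the presence of an integrable bound
  on the loss and of at least one decision, so passing to reals loses nothing.
\<close>

definition optimal_loss ::
    "'a measure \<Rightarrow> 'a measure \<Rightarrow> ('a \<Rightarrow> 'a) \<Rightarrow> 'u measure \<Rightarrow> ('u \<Rightarrow> 'a \<Rightarrow> real) \<Rightarrow> real" where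
  "optimal_loss M Y T U l =
     (\<integral>\<omega>. real_of_ereal (ess_Inf M
        {\<lambda>\<omega>. ereal (real_cond_exp M (obs M Y T {..0}) (loss M T l 0 u) \<omega>) | u.
           u \<in> decisions_upto M Y T U 0} \<omega>) \<partial>M)"

end

theory Submission
  imports Defs
begin

text \<open>
  Moving the decision \<open>u\<^sub>k\<close> to time \<open>0\<close>, that is, putting \<open>w\<^sub>k = u\<^sub>k \<circ> T\<^sup>-\<^sup>k\<close>, turns \<open>l\<^sub>k(u\<^sub>k)\<close> into
  \<open>l\<^sub>0(w\<^sub>k) \<circ> T\<^sup>k\<close>, where \<open>w\<^sub>k\<close> is one of the decisions over which the mixing assumption is uniform.
  Expanding the square, the second moment of the average of the truncated and centered losses is at
  most \<open>4 B\<^sup>2 / N\<close>, with \<open>B\<close> the truncation level, plus twice the norm in the mixing assumption. Hence \<open>L\<^sub>N(u)\<close> is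
  \<open>L\<^sup>1\<close>-asymptotic to the average of \<open>E[l\<^sub>0(w\<^sub>k) | Y\<^sub>-\<^sub>\<infinity>\<^sub>,\<^sub>0] \<circ> T\<^sup>k\<close>. These terms dominate
  \<open>V \<circ> T\<^sup>k\<close>, with \<open>V\<close> the essential infimum defining \<open>L\<^sup>\<star>\<close>, so by the mean ergodic theorem
  the negative part of \<open>L\<^sub>N(u) - L\<^sup>\<star>\<close> vanishes in \<open>L\<^sup>1\<close> for every admissible \<open>u\<close>. For the mean-optimal
  strategy the expectations also satisfy \<open>limsup E[L\<^sub>N] \<le> L\<^sup>\<star>\<close>, because \<open>L\<^sup>\<star>\<close> is the infimum of
  \<open>E[l\<^sub>0(u)]\<close> over decisions with finite memory, and the two bounds together give convergence in
  \<open>L\<^sup>1\<close>.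
\<close>

section \<open>Integrals and conditional expectations\<close>

lemma cesaro_null:
  fixes a :: "nat \<Rightarrow> real"
  assumes "a \<longlonglongrightarrow> 0"
  shows "(\<lambda>N. 1 / real N * (\<Sum>k=1..N. a k)) \<longlonglongrightarrow> 0"
proof (rule LIMSEQ_I)
  fix e :: real assume e: "0 < e"
  obtain K where K: "\<And>k. k \<ge> K \<Longrightarrow> \<bar>a k\<bar> < e / 2"
    using LIMSEQ_D[OF assms, of "e / 2"] e by auto
  define C where "C = (\<Sum>k=1..K. \<bar>a k\<bar>)"
  obtain N0 where N0: "real N0 > 2 * C / e"
    using reals_Archimedean2 by blast
  show "\<exists>no. \<forall>N\<ge>no. norm (1 / real N * (\<Sum>k=1..N. a k) - 0) < e"
  proof (intro exI allI impI)
    fix N assume N: "N \<ge> Suc (max N0 K)"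
    have "\<bar>\<Sum>k=1..N. a k\<bar> \<le> (\<Sum>k=1..N. \<bar>a k\<bar>)"
      by (rule sum_abs)
    also have "\<dots> \<le> (\<Sum>k=1..N. (if k \<le> K then \<bar>a k\<bar> else 0) + e / 2)"
      using K e by (intro sum_mono) (force intro: less_imp_le)
    also have "\<dots> = C + real N * (e / 2)"
    proof -
      have "(\<Sum>k=1..N. if k \<le> K then \<bar>a k\<bar> else 0) = (\<Sum>k=1..K. \<bar>a k\<bar>)"
        using N by (intro sum.mono_neutral_cong_right) auto
      then show ?thesis
        by (simp add: sum.distrib C_def)
    qed
    also have "\<dots> < real N * e"
    proof -
      have "2 * C < e * real N0"
        using N0 e by (simp add: field_simps)
      also have "\<dots> \<le> e * real N"
        using N e by simp
      finally show ?thesis by (simp add: field_simps)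
    qed
    finally show "norm (1 / real N * (\<Sum>k=1..N. a k) - 0) < e"
      using N by (simp add: abs_mult field_simps)
  qed
qed

text \<open>The form in which error terms are controlled below: estimates with a non-strict bound
  \<open>e\<close> for late indices are enough for a nonnegative sequence.\<close>

lemma tendsto_zero_le:
  fixes a :: "nat \<Rightarrow> real"
  assumes nonneg: "\<And>n. 0 \<le> a n"
    and small: "\<And>e. 0 < e \<Longrightarrow> eventually (\<lambda>n. a n \<le> e) sequentially"
  shows "a \<longlonglongrightarrow> 0"
proof (rule order_tendstoI)
  fix y :: real assume "y < 0"
  then show "eventually (\<lambda>n. y < a n) sequentially"
    using nonneg by (intro always_eventually) (auto intro: less_le_trans)
next
  fix y :: real assume "0 < y"
  then show "eventually (\<lambda>n. a n < y) sequentially"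
    using small[of "y / 2"] by (auto elim: eventually_mono)
qed

text \<open>The variance of \<open>\<bar>X x\<bar>\<close> is nonnegative. This passes from the
  second moment, which the mixing assumption controls, to the norm of
  \<open>L\<^sup>1\<close>.\<close>

lemma (in prob_space) expectation_abs_le_sqrt:
  fixes X :: "'a \<Rightarrow> real"
  assumes [measurable]: "X \<in> borel_measurable M" and "integrable M (\<lambda>x. (X x)\<^sup>2)"
  shows "expectation (\<lambda>x. \<bar>X x\<bar>) \<le> sqrt (expectation (\<lambda>x. (X x)\<^sup>2))"
proof -
  have int: "integrable M X"
    using assms by (rule square_integrable_imp_integrable)
  have "0 \<le> variance (\<lambda>x. \<bar>X x\<bar>)"
    by (rule variance_positive)
  also have "\<dots> = expectation (\<lambda>x. (X x)\<^sup>2) - (expectation (\<lambda>x. \<bar>X x\<bar>))\<^sup>2"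
    using int assms(2) by (subst variance_eq) auto
  finally show ?thesis
    by (intro real_le_rsqrt) simp
qed

lemma integral_tail_tendsto_zero:
  fixes g :: "'a \<Rightarrow> real"
  assumes "integrable M g"
  shows "((\<lambda>B. \<integral>x. \<bar>g x\<bar> * indicator {x. B < g x} x \<partial>M) \<longlongrightarrow> 0) at_top"
proof -
  have [measurable]: "g \<in> borel_measurable M"
    using assms by auto
  have "((\<lambda>B. \<integral>x. \<bar>g x\<bar> * indicator {x. B < g x} x \<partial>M) \<longlongrightarrow> (\<integral>x. 0 \<partial>M)) at_top"
  proof (rule integral_dominated_convergence_at_top[where w = "\<lambda>x. \<bar>g x\<bar>"])
    show "AE x in M. ((\<lambda>B. \<bar>g x\<bar> * indicator {x. B < g x} x) \<longlongrightarrow> 0) at_top"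
    proof (intro AE_I2 tendsto_eventually)
      fix x
      show "\<forall>\<^sub>F B in at_top. \<bar>g x\<bar> * indicator {x. B < g x} x = 0"
        using eventually_ge_at_top[of "g x"] by eventually_elim auto
    qed
  qed (use assms in \<open>auto simp: indicator_def\<close>)
  then show ?thesis by simp
qed

text \<open>Split \<open>g\<close> at a level \<open>c\<close> whose tail integral is below
  \<open>e / 2\<close>. On \<open>B\<close> the part below the level contributes at most
  \<open>c * measure M B\<close>, which is below \<open>e / 2\<close> for
  \<open>d = e / (2 * c)\<close>.\<close>

lemma (in finite_measure) absolute_continuity_integral:
  fixes g :: "'a \<Rightarrow> real"
  assumes g: "integrable M g" and nonneg: "\<And>x. x \<in> space M \<Longrightarrow> 0 \<le> g x" and e: "0 < e"
  obtains d where "0 < d"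
    and "\<And>B. B \<in> sets M \<Longrightarrow> measure M B < d \<Longrightarrow> (\<integral>x. g x * indicator B x \<partial>M) < e"
proof -
  have [measurable]: "g \<in> borel_measurable M"
    using g by auto
  have "\<forall>\<^sub>F c in at_top. (\<integral>x. \<bar>g x\<bar> * indicator {x. c < g x} x \<partial>M) < e / 2"
    using integral_tail_tendsto_zero[OF g] e by (intro order_tendstoD(2)) auto
  moreover have "\<forall>\<^sub>F c in at_top. 0 < (c::real)"
    by (rule eventually_gt_at_top)
  ultimately have "\<forall>\<^sub>F c in at_top. (\<integral>x. \<bar>g x\<bar> * indicator {x. c < g x} x \<partial>M) < e / 2 \<and> 0 < c"
    by (rule eventually_conj)
  then obtain c where c: "(\<integral>x. \<bar>g x\<bar> * indicator {x. c < g x} x \<partial>M) < e / 2" "0 < c"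
    using eventually_happens'[OF trivial_limit_at_top_linorder] by blast
  show ?thesis
  proof (rule that[of "e / (2 * c)"])
    show "0 < e / (2 * c)"
      using e c by simp
    fix B assume B: "B \<in> sets M" "measure M B < e / (2 * c)"
    have tail: "integrable M (\<lambda>x. \<bar>g x\<bar> * indicator {x. c < g x} x)"
      using g by (rule Bochner_Integration.integrable_bound) (auto simp: indicator_def)
    have "(\<integral>x. g x * indicator B x \<partial>M)
        \<le> (\<integral>x. c * indicator B x + \<bar>g x\<bar> * indicator {x. c < g x} x \<partial>M)"
    proof (rule integral_mono)
      show "integrable M (\<lambda>x. g x * indicator B x)"
        using B g by (intro integrable_real_mult_indicator)
      show "integrable M (\<lambda>x. c * indicator B x + \<bar>g x\<bar> * indicator {x. c < g x} x)"
        using tail B by (auto simp: emeasure_eq_measure)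
      fix x assume "x \<in> space M"
      then show "g x * indicator B x \<le> c * indicator B x + \<bar>g x\<bar> * indicator {x. c < g x} x"
        using c(2) nonneg[of x] by (auto simp: indicator_def)
    qed
    also have "\<dots> = c * measure M B + (\<integral>x. \<bar>g x\<bar> * indicator {x. c < g x} x \<partial>M)"
      using tail B by (subst Bochner_Integration.integral_add) (auto simp: emeasure_eq_measure)
    also have "\<dots> < e"
      using c B(2) by (simp add: field_simps)
    finally show "(\<integral>x. g x * indicator B x \<partial>M) < e" .
  qed
qed

lemma (in sigma_finite_subalgebra) abs_real_cond_exp_le:
  assumes f: "integrable M f" and g: "integrable M g" and le: "AE x in M. \<bar>f x\<bar> \<le> g x"
  shows "AE x in M. \<bar>real_cond_exp M F f x\<bar> \<le> real_cond_exp M F g x"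
proof -
  have "AE x in M. real_cond_exp M F f x \<le> real_cond_exp M F g x"
    using le f g by (intro real_cond_exp_mono) (auto elim!: eventually_mono)
  moreover have "AE x in M. real_cond_exp M F (\<lambda>x. - 1 * g x) x \<le> real_cond_exp M F f x"
    using le f g by (intro real_cond_exp_mono) (auto elim!: eventually_mono)
  moreover have "AE x in M. real_cond_exp M F (\<lambda>x. - 1 * g x) x = - 1 * real_cond_exp M F g x"
    using g by (rule real_cond_exp_cmult)
  ultimately show ?thesis
    by eventually_elim auto
qed

text \<open>Each off-diagonal pair is listed under its later index \<open>k\<close>, with
  \<open>i\<close> as the lag between the two indices. The mixing assumption is likewise organised
  by lags.\<close>

lemma square_sum_by_lags:
  fixes a :: "nat \<Rightarrow> 'b::comm_ring_1"
  shows "(\<Sum>k=1..N. a k)\<^sup>2 = (\<Sum>k=1..N. a k * a k + 2 * (\<Sum>i=1..<k. a (k - i) * a k))"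
proof (induction N)
  case 0
  then show ?case by simp
next
  case (Suc N)
  \<comment> \<open>Reversing the order of summation turns the index into the lag behind
    \<open>Suc N\<close>.\<close>
  have "(\<Sum>k=1..N. a k) = (\<Sum>i=1..N. a (Suc N - i))"
    using sum.atLeastAtMost_rev[of a 1 N] by simp
  also have "\<dots> * a (Suc N) = (\<Sum>i=1..<Suc N. a (Suc N - i) * a (Suc N))"
    by (simp add: sum_distrib_right atLeastLessThanSuc_atLeastAtMost)
  finally have "(\<Sum>k=1..N. a k) * a (Suc N) = (\<Sum>i=1..<Suc N. a (Suc N - i) * a (Suc N))" .
  moreover have "(\<Sum>k=1..Suc N. a k)\<^sup>2
      = (\<Sum>k=1..N. a k)\<^sup>2 + (a (Suc N) * a (Suc N) + 2 * ((\<Sum>k=1..N. a k) * a (Suc N)))"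
    by (simp add: power2_eq_square algebra_simps)
  ultimately show ?case
    using Suc by simp
qed

section \<open>The mean ergodic theorem\<close>

locale ergodic_system = prob_space M for M :: "'a measure" +
  fixes T :: "'a \<Rightarrow> 'a"
  assumes ergodic: "ergodic_automorphism M T"
begin

abbreviation "Tinv \<equiv> inv_into (space M) T"

abbreviation "\<theta> \<equiv> tpow M T"

lemma bij_T: "bij_betw T (space M) (space M)"
  and measurable_T [measurable]: "T \<in> M \<rightarrow>\<^sub>M M"
  and measurable_Tinv [measurable]: "Tinv \<in> M \<rightarrow>\<^sub>M M"
  and distr_T: "distr M M T = M"
  using ergodic by (auto simp: ergodic_automorphism_def)

lemma Tinv_T: "x \<in> space M \<Longrightarrow> Tinv (T x) = x"
  and T_Tinv: "x \<in> space M \<Longrightarrow> T (Tinv x) = x"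
  using bij_T by (auto simp: bij_betw_inv_into_left bij_betw_inv_into_right)

lemma distr_Tinv: "distr M M Tinv = M"
proof -
  have "distr M M Tinv = distr (distr M M T) M Tinv"
    by (simp add: distr_T)
  also have "\<dots> = distr M M (Tinv \<circ> T)"
    by (rule distr_distr) auto
  also have "\<dots> = distr M M (\<lambda>x. x)"
    by (rule distr_cong) (auto simp: Tinv_T)
  finally show ?thesis by simp
qed

section \<open>Integer powers of the automorphism and invariance of integrals\<close>

lemma measurable_funpow: "f \<in> M \<rightarrow>\<^sub>M M \<Longrightarrow> f ^^ n \<in> M \<rightarrow>\<^sub>M M"
  by (induction n) (auto intro: measurable_comp simp: id_def[symmetric])

lemma distr_funpow:
  assumes f: "f \<in> M \<rightarrow>\<^sub>M M" and "distr M M f = M"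
  shows "distr M M (f ^^ n) = M"
proof (induction n)
  case 0
  then show ?case by (simp add: id_def)
next
  case (Suc n)
  have "distr M M (f ^^ Suc n) = distr (distr M M (f ^^ n)) M f"
    by (subst distr_distr) (auto simp: measurable_funpow f)
  with Suc assms(2) show ?case by (simp add: o_def)
qed

lemma measurable_tpow [measurable]: "\<theta> k \<in> M \<rightarrow>\<^sub>M M"
  and distr_tpow: "distr M M (\<theta> k) = M"
  by (auto simp: tpow_def measurable_funpow distr_funpow distr_T distr_Tinv)

lemma tpow_space [simp]: "x \<in> space M \<Longrightarrow> \<theta> k x \<in> space M"
  using measurable_space[OF measurable_tpow] .

lemma tpow_0 [simp]: "\<theta> 0 x = x"
  by (simp add: tpow_def)

lemma tpow_int: "\<theta> (int n) = T ^^ n"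
  by (simp add: tpow_def)

lemma tpow_plus_1: "x \<in> space M \<Longrightarrow> \<theta> (k + 1) x = T (\<theta> k x)"
proof (cases "0 \<le> k")
  case True
  then show ?thesis by (simp add: tpow_def nat_add_distrib)
next
  case False
  assume x: "x \<in> space M"
  \<comment> \<open>One of the \<open>Suc m\<close> inverse factors is cancelled by
    \<open>T\<close>. The case \<open>m = 0\<close> is separated below because
    \<open>k + 1 = 0\<close> then belongs to the nonnegative branch of \<open>tpow\<close>.\<close>
  define m where "m = nat (- k) - 1"
  have k: "nat (- k) = Suc m" "k + 1 = - int m"
    using False by (auto simp: m_def)
  have "(Tinv ^^ m) x \<in> space M"
    using measurable_space[OF measurable_funpow[OF measurable_Tinv] x] .
  then show ?thesis
    using False k by (cases "m = 0") (auto simp: tpow_def T_Tinv)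
qed

lemma tpow_minus_1: "x \<in> space M \<Longrightarrow> \<theta> (k - 1) x = Tinv (\<theta> k x)"
  using tpow_plus_1[of x "k - 1"] Tinv_T[of "\<theta> (k - 1) x"] by simp

lemma tpow_tpow: "x \<in> space M \<Longrightarrow> \<theta> j (\<theta> k x) = \<theta> (j + k) x"
proof (induction j rule: int_induct[of _ 0])
  case base
  then show ?case by simp
next
  case (step1 j)
  then show ?case
    using tpow_plus_1[of "\<theta> k x" j] tpow_plus_1[of x "j + k"] by (simp add: ac_simps)
next
  case (step2 j)
  then show ?case
    using tpow_minus_1[of "\<theta> k x" j] tpow_minus_1[of x "j + k"] by (simp add: algebra_simps)
qed

lemma integral_tpow:
  fixes f :: "'a \<Rightarrow> real"
  assumes "f \<in> borel_measurable M"
  shows "(\<integral>x. f (\<theta> k x) \<partial>M) = (\<integral>x. f x \<partial>M)"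
  using integral_distr[OF measurable_tpow assms, of k] by (simp add: distr_tpow)

lemma integrable_tpow:
  fixes f :: "'a \<Rightarrow> real"
  assumes "integrable M f"
  shows "integrable M (\<lambda>x. f (\<theta> k x))"
  by (rule integrable_distr[OF measurable_tpow]) (simp add: distr_tpow assms)

lemma AE_tpow:
  assumes "AE x in M. P x"
  shows "AE x in M. P (\<theta> k x)"
  using assms by (intro AE_distrD[OF measurable_tpow, where P = P]) (simp only: distr_tpow)

text \<open>
  Garsia's argument: with \<open>m n\<close> the running maximum of the partial sums, the integral of
  \<open>m (Suc n) - m n \<circ> T = max (- (m n \<circ> T)) f\<close> is nonnegative, and this function tends to \<open>f\<close>
  where the partial sums are unbounded above.
\<close>

lemma AE_bdd_above_partial_sums:
  fixes f :: "'a \<Rightarrow> real"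
  assumes f: "integrable M f" and neg: "expectation f < 0"
  shows "AE x in M. \<exists>c. \<forall>n. (\<Sum>i<n. f ((T ^^ i) x)) \<le> c"
proof -
  have [measurable]: "f \<in> borel_measurable M"
    using f by auto
  define m where "m = rec_nat (\<lambda>x. 0) (\<lambda>n g x. max 0 (f x + g (T x)))"
  have m0: "m 0 x = 0" and mS: "m (Suc n) x = max 0 (f x + m n (T x))" for n x
    by (auto simp: m_def)
  have m_int: "integrable M (m n)" for n
  proof (induction n)
    case 0
    then show ?case by (simp add: m0 [abs_def])
  next
    case (Suc n)
    then show ?case
      using f integrable_tpow[OF Suc, of 1] tpow_int[of 1] by (simp add: mS [abs_def])
  qed
  then have [measurable]: "m n \<in> borel_measurable M" for n
    by auto
  have m_nonneg: "0 \<le> m n x" for n x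
    by (cases n) (auto simp: m0 mS)
  have "m n x \<le> m (Suc n) x" for n x
  proof (induction n arbitrary: x)
    case (Suc n)
    then show ?case
      unfolding mS[of n x] mS[of "Suc n" x] by (intro max.mono add_left_mono order.refl)
  qed (simp add: m0 mS)
  then have m_mono: "i \<le> j \<Longrightarrow> m i x \<le> m j x" for i j x
    by (rule lift_Suc_mono_le)
  have sum_le: "(\<Sum>i<n. f ((T ^^ i) x)) \<le> m n x" for n x
  proof (induction n arbitrary: x)
    case 0
    then show ?case by (simp add: m0)
  next
    case (Suc n)
    have "(\<Sum>i<Suc n. f ((T ^^ i) x)) = f x + (\<Sum>i<n. f ((T ^^ i) (T x)))"
      by (subst sum.lessThan_Suc_shift) (simp add: funpow_swap1)
    also have "\<dots> \<le> m (Suc n) x"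
      using Suc[of "T x"] by (simp add: mS)
    finally show ?case .
  qed
  \<comment> \<open>On this event the running maxima are unbounded. Passing from \<open>x\<close> to
    \<open>T x\<close> changes them only by \<open>f x\<close> once they are positive, so the event
    is strictly invariant and ergodicity applies.\<close>
  define A where "A = {x \<in> space M. \<forall>c::nat. \<exists>n. real c < m n x}"
  have A_sets: "A \<in> sets M"
    unfolding A_def by measurable
  have A_iff: "T x \<in> A \<longleftrightarrow> x \<in> A" if x: "x \<in> space M" for x
  proof
    assume Tx: "T x \<in> A"
    show "x \<in> A"
      unfolding A_def
    proof (safe intro!: x)
      fix c :: nat
      obtain d :: nat where d: "real c - f x < real d"
        using reals_Archimedean2 by blast
      then obtain n where "real d < m n (T x)"
        using Tx by (auto simp: A_def)
      then show "\<exists>n. real c < m n x"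
        using d by (intro exI[of _ "Suc n"]) (auto simp: mS)
    qed
  next
    assume xA: "x \<in> A"
    show "T x \<in> A"
      unfolding A_def
    proof (safe intro!: measurable_space[OF measurable_T x])
      fix c :: nat
      \<comment> \<open>Since \<open>d\<close> exceeds 0 and \<open>m 0\<close> vanishes,
        \<open>n\<close> is a successor and the maximum in \<open>mS\<close> is its second argument.
        Since \<open>d\<close> exceeds \<open>real c + f x\<close>, more than \<open>c\<close>
        remains after removing \<open>f x\<close>.\<close>
      obtain d :: nat where d: "max 0 (real c + f x) < real d"
        using reals_Archimedean2 by blast
      obtain n where n: "real d < m n x"
        using xA by (auto simp: A_def)
      then obtain n' where "n = Suc n'"
        using d by (cases n) (auto simp: m0)
      with n d show "\<exists>n. real c < m n (T x)"
        by (intro exI[of _ n']) (auto simp: mS)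
    qed
  qed
  have "T -` A \<inter> space M = A"
    using A_iff by (auto simp: A_def)
  then have "prob A = 0 \<or> prob A = 1"
    using ergodic A_sets by (auto simp: ergodic_automorphism_def)
  moreover have "prob A \<noteq> 1"
  proof
    assume "prob A = 1"
    then have A: "AE x in M. x \<in> A"
      using A_sets by (simp add: AE_in_set_eq_1)
    have "(\<lambda>n. \<integral>x. max (- m n (T x)) (f x) \<partial>M) \<longlonglongrightarrow> (\<integral>x. f x \<partial>M)"
    proof (rule integral_dominated_convergence[where w = "\<lambda>x. \<bar>f x\<bar>"])
      show "AE x in M. (\<lambda>n. max (- m n (T x)) (f x)) \<longlonglongrightarrow> f x"
        using A AE_space
      proof eventually_elim
        case (elim x)
        then have "T x \<in> A"
          using A_iff by auto
        moreover obtain c :: nat where c: "- f x < real c"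
          using reals_Archimedean2 by blast
        ultimately obtain n where n: "real c < m n (T x)"
          by (auto simp: A_def)
        have "max (- m k (T x)) (f x) = f x" if "k \<ge> n" for k
          using m_mono[OF that, of "T x"] n c by auto
        then show ?case
          by (intro tendsto_eventually) (auto simp: eventually_sequentially)
      qed
      show "AE x in M. norm (max (- m n (T x)) (f x)) \<le> \<bar>f x\<bar>" for n
        using m_nonneg by (intro AE_I2) (auto simp: max_def)
    qed (use f in auto)
    moreover have "0 \<le> (\<integral>x. max (- m n (T x)) (f x) \<partial>M)" for n
    proof -
      have int: "integrable M (\<lambda>x. m n (T x))"
        using integrable_tpow[OF m_int, of n 1] tpow_int[of 1] by simp
      have "0 \<le> (\<integral>x. m (Suc n) x - m n x \<partial>M)"
        using m_mono by (intro integral_nonneg_AE AE_I2) auto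
      also have "\<dots> = (\<integral>x. m (Suc n) x \<partial>M) - (\<integral>x. m n (T x) \<partial>M)"
        using m_int integral_tpow[of "m n" 1] tpow_int[of 1] by simp
      also have "\<dots> = (\<integral>x. m (Suc n) x - m n (T x) \<partial>M)"
        using m_int int by simp
      also have "\<dots> = (\<integral>x. max (- m n (T x)) (f x) \<partial>M)"
        by (intro Bochner_Integration.integral_cong) (auto simp: mS max_def)
      finally show ?thesis .
    qed
    ultimately have "0 \<le> expectation f"
      by (intro LIMSEQ_le_const) auto
    with neg show False by simp
  qed
  ultimately have "AE x in M. x \<notin> A"
    using A_sets by (simp add: prob_eq_0)
  then show ?thesis
    using AE_space
  proof eventually_elim
    case (elim x)
    then obtain c :: nat where "\<forall>n. m n x \<le> real c"
      by (auto simp: A_def not_less)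
    then show ?case
      using sum_le order.trans by blast
  qed
qed

text \<open>Subtracting \<open>expectation f + e / 2\<close> makes the mean negative, so the
  centered partial sums stay below a constant depending on the point. The remaining
  \<open>e / 2\<close> per step absorbs that constant for large \<open>n\<close>.\<close>

lemma AE_limsup_averages_le:
  fixes f :: "'a \<Rightarrow> real"
  assumes f: "integrable M f" and e: "0 < e"
  shows "AE x in M. \<forall>\<^sub>F n in sequentially. 1 / real n * (\<Sum>i<n. f ((T ^^ i) x)) \<le> expectation f + e"
proof -
  let ?c = "expectation f + e / 2"
  have "expectation (\<lambda>x. f x - ?c) < 0"
    using f e by (simp add: prob_space)
  then have "AE x in M. \<exists>c. \<forall>n. (\<Sum>i<n. f ((T ^^ i) x) - ?c) \<le> c"
    using f by (intro AE_bdd_above_partial_sums) auto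
  then show ?thesis
  proof eventually_elim
    case (elim x)
    then obtain c where c: "\<And>n. (\<Sum>i<n. f ((T ^^ i) x)) \<le> c + real n * ?c"
      by (auto simp: sum_subtractf algebra_simps)
    obtain N :: nat where N: "2 * c / e < real N"
      using reals_Archimedean2 by blast
    show ?case
    proof (rule eventually_sequentiallyI[of "Suc N"])
      fix n assume n: "Suc N \<le> n"
      have "2 * c < e * real N"
        using N e by (simp add: field_simps)
      also have "\<dots> \<le> e * real n"
        using n e by simp
      finally have "c + real n * ?c \<le> real n * (expectation f + e)"
        by (simp add: field_simps)
      with c[of n] have "(\<Sum>i<n. f ((T ^^ i) x)) \<le> real n * (expectation f + e)"
        by linarith
      then show "1 / real n * (\<Sum>i<n. f ((T ^^ i) x)) \<le> expectation f + e"
        using n by (simp add: field_simps)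
    qed
  qed
qed

text \<open>The one-sided bound is applied to \<open>f\<close> and to its negative. Using only the
  tolerances \<open>1 / real (Suc k)\<close> leaves a countable union of null sets to
  discard.\<close>

theorem birkhoff:
  fixes f :: "'a \<Rightarrow> real"
  assumes f: "integrable M f"
  shows "AE x in M. (\<lambda>n. 1 / real n * (\<Sum>i<n. f ((T ^^ i) x))) \<longlonglongrightarrow> expectation f"
proof -
  have "AE x in M. \<forall>k. \<forall>\<^sub>F n in sequentially.
      1 / real n * (\<Sum>i<n. f ((T ^^ i) x)) \<le> expectation f + 1 / real (Suc k)"
    unfolding AE_all_countable using AE_limsup_averages_le[OF f] by auto
  moreover have "AE x in M. \<forall>k. \<forall>\<^sub>F n in sequentially.
      1 / real n * (\<Sum>i<n. - f ((T ^^ i) x)) \<le> expectation (\<lambda>x. - f x) + 1 / real (Suc k)"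
    unfolding AE_all_countable using AE_limsup_averages_le[of "\<lambda>x. - f x"] f by auto
  ultimately show ?thesis
  proof eventually_elim
    case (elim x)
    show ?case
    proof (rule LIMSEQ_I)
      fix r :: real assume "0 < r"
      then obtain k where k: "1 / real (Suc k) < r"
        using nat_approx_posE by blast
      have "\<forall>\<^sub>F n in sequentially. norm (1 / real n * (\<Sum>i<n. f ((T ^^ i) x)) - expectation f) < r"
        using elim(1)[rule_format, of k] elim(2)[rule_format, of k]
      proof eventually_elim
        case (elim n)
        then show ?case
          using k by (simp add: sum_negf abs_less_iff)
      qed
      then show "\<exists>no. \<forall>n\<ge>no. norm (1 / real n * (\<Sum>i<n. f ((T ^^ i) x)) - expectation f) < r"
        by (simp add: eventually_sequentially)
    qed
  qed
qed

section \<open>Averages along the orbit in the mean\<close>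

lemma integrable_average:
  fixes f :: "nat \<Rightarrow> 'a \<Rightarrow> real"
  assumes "\<And>k. k \<ge> 1 \<Longrightarrow> integrable M (f k)"
  shows "integrable M (\<lambda>x. 1 / real N * (\<Sum>k=1..N. f k (\<theta> (int k) x)))"
  using assms by (intro integrable_mult_right Bochner_Integration.integrable_sum integrable_tpow) auto

text \<open>By invariance each shifted summand has the same norm as \<open>f k\<close>, so the
  triangle inequality gives a bound uniform in \<open>N\<close>. The functions may vary with
  \<open>k\<close>, as the decisions of a strategy do.\<close>

lemma L1_average_le:
  fixes f :: "nat \<Rightarrow> 'a \<Rightarrow> real"
  assumes f: "\<And>k. k \<ge> 1 \<Longrightarrow> integrable M (f k)"
    and c: "\<And>k. k \<ge> 1 \<Longrightarrow> expectation (\<lambda>x. \<bar>f k x\<bar>) \<le> c" "0 \<le> c"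
  shows "expectation (\<lambda>x. \<bar>1 / real N * (\<Sum>k=1..N. f k (\<theta> (int k) x))\<bar>) \<le> c"
proof -
  have int: "integrable M (\<lambda>x. \<bar>f k (\<theta> (int k) x)\<bar>)" if "k \<in> {1..N}" for k
    using integrable_tpow[OF f, of k "int k"] that by auto
  have "expectation (\<lambda>x. \<bar>1 / real N * (\<Sum>k=1..N. f k (\<theta> (int k) x))\<bar>)
      \<le> expectation (\<lambda>x. 1 / real N * (\<Sum>k=1..N. \<bar>f k (\<theta> (int k) x)\<bar>))"
  proof (rule integral_mono)
    show "integrable M (\<lambda>x. \<bar>1 / real N * (\<Sum>k=1..N. f k (\<theta> (int k) x))\<bar>)"
      using integrable_average[of f N, OF f] by (rule integrable_abs)
    show "integrable M (\<lambda>x. 1 / real N * (\<Sum>k=1..N. \<bar>f k (\<theta> (int k) x)\<bar>))"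
      using int by (intro integrable_mult_right Bochner_Integration.integrable_sum)
  qed (auto simp: abs_mult intro!: divide_right_mono)
  also have "\<dots> = 1 / real N * (\<Sum>k=1..N. expectation (\<lambda>x. \<bar>f k (\<theta> (int k) x)\<bar>))"
    using int by (subst integral_mult_right_zero, subst Bochner_Integration.integral_sum) auto
  also have "\<dots> = 1 / real N * (\<Sum>k=1..N. expectation (\<lambda>x. \<bar>f k x\<bar>))"
    using f integral_tpow by (intro arg_cong2[where f = "(*)"] sum.cong refl)
      (auto intro!: integral_tpow[of "\<lambda>x. \<bar>f _ x\<bar>"])
  also have "\<dots> \<le> 1 / real N * (\<Sum>k=1..N. c)"
    using c by (intro mult_left_mono sum_mono) auto
  \<comment> \<open>Only an inequality: for \<open>N = 0\<close> the left side is 0, which is where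
    \<open>0 \<le> c\<close> enters.\<close>
  also have "\<dots> \<le> c"
    using c(2) by auto
  finally show ?thesis .
qed

text \<open>For the bounded function \<open>g B\<close>, obtained by clipping \<open>f\<close>,
  pointwise convergence becomes convergence in the mean by dominated convergence. The clipping error
  costs at most \<open>e / 3\<close> in the averages, uniformly in \<open>N\<close>, and at most
  \<open>e / 3\<close> in the expectation.\<close>

theorem mean_ergodic:
  fixes f :: "'a \<Rightarrow> real"
  assumes f: "integrable M f"
  shows "(\<lambda>N. expectation (\<lambda>x. \<bar>1 / real N * (\<Sum>k=1..N. f (\<theta> (int k) x)) - expectation f\<bar>)) \<longlonglongrightarrow> 0"
proof (rule tendsto_zero_le)
  fix e :: real assume e: "0 < e"
  have [measurable]: "f \<in> borel_measurable M"
    using f by auto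
  define g where "g B x = max (- real B) (min (real B) (f x))" for B :: nat and x
  have [measurable]: "g B \<in> borel_measurable M" for B
    unfolding g_def by measurable
  have g_bound: "\<bar>g B x\<bar> \<le> real B" for B x
    by (auto simp: g_def)
  have g_int: "integrable M (g B)" for B
    using g_bound by (intro integrable_const_bound[of _ "real B"]) auto
  have "(\<lambda>B. expectation (\<lambda>x. \<bar>f x - g B x\<bar>)) \<longlonglongrightarrow> expectation (\<lambda>x. 0)"
  proof (rule integral_dominated_convergence[where w = "\<lambda>x. \<bar>f x\<bar>"])
    show "AE x in M. (\<lambda>B. \<bar>f x - g B x\<bar>) \<longlonglongrightarrow> 0"
    proof (intro AE_I2 tendsto_eventually)
      fix x
      obtain B :: nat where "\<bar>f x\<bar> < real B"
        using reals_Archimedean2 by blast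
      then have "\<bar>f x - g C x\<bar> = 0" if "C \<ge> B" for C
        using of_nat_mono[OF that, where 'a = real] by (auto simp: g_def min_def max_def abs_if split: if_splits)
      then show "\<forall>\<^sub>F C in sequentially. \<bar>f x - g C x\<bar> = 0"
        by (auto simp: eventually_sequentially)
    qed
  qed (use f in \<open>auto simp: g_def min_def max_def\<close>)
  then have "\<forall>\<^sub>F B in sequentially. expectation (\<lambda>x. \<bar>f x - g B x\<bar>) < e / 3"
    using e by (intro order_tendstoD(2)) auto
  then obtain B where B: "expectation (\<lambda>x. \<bar>f x - g B x\<bar>) \<le> e / 3"
    by (auto simp: eventually_sequentially intro: less_imp_le)
  let ?A = "\<lambda>h N x. 1 / real N * (\<Sum>k=1..N. h (\<theta> (int k) x))"
  have "(\<lambda>N. expectation (\<lambda>x. \<bar>?A (g B) N x - expectation (g B)\<bar>)) \<longlonglongrightarrow> expectation (\<lambda>x. 0)"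
  proof (rule integral_dominated_convergence[where w = "\<lambda>x. 2 * real B"])
    \<comment> \<open>The averages here start at time 1 and those in \<open>birkhoff\<close> at time
      0. The extra \<open>T\<close> inside \<open>g B\<close> bridges the two and leaves the
      expectation unchanged.\<close>
    have eq: "?A (g B) N x = 1 / real N * (\<Sum>i<N. g B (T ((T ^^ i) x)))" for N x
      by (simp add: sum.atLeast1_atMost_eq tpow_int)
    have int: "integrable M (\<lambda>x. g B (T x))" and Eg: "expectation (\<lambda>x. g B (T x)) = expectation (g B)"
      using integrable_tpow[OF g_int, of B 1] integral_tpow[of "g B" 1] tpow_int[of 1] by auto
    show "AE x in M. (\<lambda>N. \<bar>?A (g B) N x - expectation (g B)\<bar>) \<longlonglongrightarrow> 0"
      using birkhoff[OF int]
    proof eventually_elim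
      case (elim x)
      then show ?case
        unfolding eq Eg by (intro tendsto_rabs_zero) (simp add: LIM_zero_iff)
    qed
    show "AE x in M. norm \<bar>?A (g B) N x - expectation (g B)\<bar> \<le> 2 * real B" for N
    proof (intro AE_I2)
      fix x
      have "\<bar>?A (g B) N x\<bar> \<le> 1 / real N * (\<Sum>k=1..N. real B)"
        unfolding abs_mult using g_bound
        by (intro mult_mono order.trans[OF sum_abs] sum_mono) auto
      also have "\<dots> \<le> real B"
        by simp
      finally have "\<bar>?A (g B) N x\<bar> \<le> real B" .
      moreover have "\<bar>expectation (g B)\<bar> \<le> real B"
      proof -
        have "\<bar>expectation (g B)\<bar> \<le> expectation (\<lambda>x. real B)"
          using g_bound g_int by (intro order.trans[OF integral_abs_bound] integral_mono) auto
        then show ?thesis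
          by (simp add: prob_space)
      qed
      ultimately show "norm \<bar>?A (g B) N x - expectation (g B)\<bar> \<le> 2 * real B"
        unfolding real_norm_def using abs_triangle_ineq4[of "?A (g B) N x" "expectation (g B)"] by linarith
    qed
  qed (auto simp: tpow_int)
  then have "\<forall>\<^sub>F N in sequentially. expectation (\<lambda>x. \<bar>?A (g B) N x - expectation (g B)\<bar>) < e / 3"
    using e by (intro order_tendstoD(2)) auto
  then show "\<forall>\<^sub>F N in sequentially. expectation (\<lambda>x. \<bar>?A f N x - expectation f\<bar>) \<le> e"
  proof eventually_elim
    case (elim N)
    let ?d = "\<lambda>x. f x - g B x"
    have d_int: "integrable M ?d"
      using f g_int by auto
    have split: "?A f N x - expectation f
        = ?A ?d N x + (?A (g B) N x - expectation (g B)) - expectation ?d" for x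
      using f g_int by (simp add: sum_subtractf algebra_simps diff_divide_distrib)
    have A_int: "integrable M (?A h N)" if "integrable M h" for h
      using integrable_average[of "\<lambda>_. h"] that by simp
    define p where "p = ?A ?d N"
    define q where "q x = ?A (g B) N x - expectation (g B)" for x
    have pq: "integrable M p" "integrable M q"
      using A_int[OF d_int] A_int[OF g_int, of B] by (auto simp: p_def q_def[abs_def])
    have "expectation (\<lambda>x. \<bar>?A f N x - expectation f\<bar>)
        \<le> expectation (\<lambda>x. \<bar>p x\<bar> + \<bar>q x\<bar> + \<bar>expectation ?d\<bar>)"
    proof (rule integral_mono)
      show "integrable M (\<lambda>x. \<bar>?A f N x - expectation f\<bar>)"
        using A_int[OF f] by auto
      show "integrable M (\<lambda>x. \<bar>p x\<bar> + \<bar>q x\<bar> + \<bar>expectation ?d\<bar>)"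
        using pq by auto
      fix x
      show "\<bar>?A f N x - expectation f\<bar> \<le> \<bar>p x\<bar> + \<bar>q x\<bar> + \<bar>expectation ?d\<bar>"
        unfolding split p_def q_def by linarith
    qed
    also have "\<dots> = expectation (\<lambda>x. \<bar>p x\<bar>) + expectation (\<lambda>x. \<bar>q x\<bar>) + \<bar>expectation ?d\<bar>"
      using pq by (simp add: prob_space)
    also have "expectation (\<lambda>x. \<bar>p x\<bar>) \<le> e / 3"
      unfolding p_def using L1_average_le[of "\<lambda>_. ?d" "e / 3" N] d_int B e by simp
    also have "\<bar>expectation ?d\<bar> \<le> e / 3"
      using integral_abs_bound[of M ?d] B by linarith
    finally show ?case
      using elim unfolding q_def by linarith
  qed
qed auto

end

section \<open>Approximation of the essential infimum by decisions with finite memory\<close>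

locale decision_problem = ergodic_system M T
  for M :: "'a measure" and T :: "'a \<Rightarrow> 'a" +
  fixes Y :: "'a measure"
    and U :: "'u measure"
    and l :: "'u \<Rightarrow> 'a \<Rightarrow> real"
    and \<Lambda> :: "'a \<Rightarrow> real"
  assumes subalg: "subalgebra M Y"
    and measurable_l [measurable]: "(\<lambda>(x, \<omega>). l x \<omega>) \<in> borel_measurable (U \<Otimes>\<^sub>M M)"
    and integrable_\<Lambda>: "integrable M \<Lambda>"
    and l_bound: "\<And>x \<omega>. x \<in> space U \<Longrightarrow> \<omega> \<in> space M \<Longrightarrow> \<bar>l x \<omega>\<bar> \<le> \<Lambda> \<omega>"
    and space_U: "space U \<noteq> {}"
begin

abbreviation "\<F> \<equiv> obs M Y T"

abbreviation "\<F>0 \<equiv> obs M Y T {..0}"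

abbreviation "\<U>0 \<equiv> decisions_upto M Y T U 0"

abbreviation "cond0 \<equiv> real_cond_exp M (obs M Y T {..0})"

abbreviation "loss0 \<equiv> loss M T l 0"

lemma measurable_\<Lambda> [measurable]: "\<Lambda> \<in> borel_measurable M"
  using integrable_\<Lambda> by auto

lemma \<Lambda>_nonneg: "\<omega> \<in> space M \<Longrightarrow> 0 \<le> \<Lambda> \<omega>"
  using l_bound space_U by (metis abs_ge_zero all_not_in_conv order.trans)

text \<open>The powers \<open>- k\<close> and \<open>k\<close> are mutually inverse on the space.
  Rewriting the generators of \<open>obs\<close> as preimages makes their measurability a
  consequence of that of \<open>tpow\<close>.\<close>

lemma tpow_image:
  assumes "A \<in> sets Y"
  shows "\<theta> (- k) ` A = \<theta> k -` A \<inter> space M"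
proof -
  have A: "A \<subseteq> space M"
    using assms subalg sets.sets_into_space by (fastforce simp: subalgebra_def)
  then have "\<theta> k (\<theta> (- k) x) = x" if "x \<in> A" for x
    using that by (subst tpow_tpow) auto
  moreover have "y = \<theta> (- k) (\<theta> k y)" if "y \<in> space M" for y
    using that by (subst tpow_tpow) auto
  ultimately show ?thesis
    using A by (auto simp: image_iff; metis)
qed

lemma space_obs: "space (\<F> K) = space M"
  by (simp add: obs_def space_measure_of_conv)

lemma obs_generators: "(\<Union>k\<in>K. (\<lambda>A. \<theta> (- k) ` A) ` sets Y) \<subseteq> Pow (space M)"
  by (auto simp: tpow_image)

lemma sets_obs: "sets (\<F> K) = sigma_sets (space M) (\<Union>k\<in>K. (\<lambda>A. \<theta> (- k) ` A) ` sets Y)"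
  unfolding obs_def by (rule sets_measure_of[OF obs_generators])

lemma subalgebra_obs: "subalgebra M (\<F> K)"
proof -
  have "A \<in> sets M" if "A \<in> sets Y" for A
    using subalg that by (auto simp: subalgebra_def)
  then have "(\<Union>k\<in>K. (\<lambda>A. \<theta> (- k) ` A) ` sets Y) \<subseteq> sets M"
    by (auto simp: tpow_image)
  then show ?thesis
    unfolding subalgebra_def space_obs sets_obs by (auto intro: sets.sigma_sets_subset[THEN subsetD])
qed

lemma sets_obs_subset: "A \<in> sets (\<F> K) \<Longrightarrow> A \<in> sets M"
  using subalgebra_obs by (auto simp: subalgebra_def)

lemma sets_obs_mono: "K \<subseteq> K' \<Longrightarrow> sets (\<F> K) \<subseteq> sets (\<F> K')"
  unfolding sets_obs by (intro sigma_sets_mono') auto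

lemma measurable_obs_mono: "K \<subseteq> K' \<Longrightarrow> u \<in> \<F> K \<rightarrow>\<^sub>M N \<Longrightarrow> u \<in> \<F> K' \<rightarrow>\<^sub>M N"
  using sets_obs_mono[of K K'] by (auto simp: measurable_def space_obs)

lemma measurable_obs_M: "u \<in> \<F> K \<rightarrow>\<^sub>M N \<Longrightarrow> u \<in> M \<rightarrow>\<^sub>M N"
  by (rule measurable_from_subalg[OF subalgebra_obs])

text \<open>The preimage under \<open>\<theta> j\<close> of a generator observed at time
  \<open>k\<close> is the generator observed at time \<open>k + j\<close>, so shifting a decision by
  \<open>j\<close> shifts the window of observations it uses by \<open>j\<close>.\<close>

lemma measurable_tpow_obs:
  assumes "\<And>k. k \<in> K \<Longrightarrow> k + j \<in> K'"
  shows "\<theta> j \<in> \<F> K' \<rightarrow>\<^sub>M \<F> K"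
  unfolding obs_def[of M Y T K]
proof (rule measurable_measure_of[OF obs_generators])
  show "\<theta> j \<in> space (\<F> K') \<rightarrow> space M"
    by (auto simp: space_obs)
  fix B assume "B \<in> (\<Union>k\<in>K. (\<lambda>A. \<theta> (- k) ` A) ` sets Y)"
  then obtain k A where k: "k \<in> K" "A \<in> sets Y" "B = \<theta> (- k) ` A"
    by auto
  have "\<theta> j -` B \<inter> space (\<F> K') = \<theta> (- (k + j)) ` A"
    unfolding k(3) tpow_image[OF k(2)] space_obs by (auto simp: tpow_tpow)
  also have "\<dots> \<in> sets (\<F> K')"
    unfolding sets_obs using k assms by (intro sigma_sets.Basic) blast
  finally show "\<theta> j -` B \<inter> space (\<F> K') \<in> sets (\<F> K')" .
qed

lemma decisions_tpow:
  assumes "u \<in> decisions M Y T U m n"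
  shows "(\<lambda>\<omega>. u (\<theta> j \<omega>)) \<in> decisions M Y T U (m + j) (n + j)"
  using assms unfolding decisions_def
  by (intro measurable_compose[OF measurable_tpow_obs]) auto

lemma decisions_mono: "m' \<le> m \<Longrightarrow> decisions M Y T U m n \<subseteq> decisions M Y T U m' n"
  unfolding decisions_def by (auto intro: measurable_obs_mono[rotated])

lemma decisions_measurable: "u \<in> decisions M Y T U m n \<Longrightarrow> u \<in> M \<rightarrow>\<^sub>M U"
  unfolding decisions_def by (rule measurable_obs_M)

lemma decisions_upto_measurable_\<F>0: "u \<in> \<U>0 \<Longrightarrow> u \<in> \<F>0 \<rightarrow>\<^sub>M U"
  unfolding decisions_upto_def decisions_def by (auto intro: measurable_obs_mono[rotated])

lemma decisions_upto_measurable: "u \<in> \<U>0 \<Longrightarrow> u \<in> M \<rightarrow>\<^sub>M U"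
  by (rule measurable_obs_M[OF decisions_upto_measurable_\<F>0])

lemma decisions_upto_nonempty: "\<U>0 \<noteq> {}"
proof -
  obtain c where "c \<in> space U"
    using space_U by auto
  then have "(\<lambda>_. c) \<in> decisions M Y T U 0 0"
    by (auto simp: decisions_def)
  then show ?thesis
    by (auto simp: decisions_upto_def)
qed

lemma loss_measurable [measurable]:
  assumes [measurable]: "u \<in> M \<rightarrow>\<^sub>M U"
  shows "loss M T l k u \<in> borel_measurable M"
proof -
  have "(\<lambda>\<omega>. case (u \<omega>, \<theta> k \<omega>) of (x, \<omega>) \<Rightarrow> l x \<omega>) \<in> borel_measurable M"
    by measurable
  then show ?thesis
    by (simp add: loss_def [abs_def])
qed

lemma loss_bound:
  "u \<in> M \<rightarrow>\<^sub>M U \<Longrightarrow> \<omega> \<in> space M \<Longrightarrow> \<bar>loss M T l k u \<omega>\<bar> \<le> \<Lambda> (\<theta> k \<omega>)"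
  unfolding loss_def by (intro l_bound measurable_space[of u M U]) auto

lemma loss0_bound: "u \<in> M \<rightarrow>\<^sub>M U \<Longrightarrow> \<omega> \<in> space M \<Longrightarrow> \<bar>loss0 u \<omega>\<bar> \<le> \<Lambda> \<omega>"
  using loss_bound[of u \<omega> 0] by simp

lemma integrable_loss:
  assumes "u \<in> M \<rightarrow>\<^sub>M U"
  shows "integrable M (loss M T l k u)"
  using integrable_tpow[OF integrable_\<Lambda>, of k]
  by (rule Bochner_Integration.integrable_bound)
     (use loss_bound[OF assms, of _ k] assms in \<open>auto intro!: AE_I2 order.trans[OF _ abs_ge_self]\<close>)

lemma loss_tpow:
  assumes "\<omega> \<in> space M"
  shows "loss M T l k u \<omega> = loss0 (\<lambda>\<omega>. u (\<theta> (- k) \<omega>)) (\<theta> k \<omega>)"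
  using assms by (simp add: loss_def tpow_tpow)

lemma finite_subalgebra_obs: "finite_measure_subalgebra M (\<F> K)"
  by unfold_locales (rule subalgebra_obs)

sublocale F0: finite_measure_subalgebra M \<F>0
  by (rule finite_subalgebra_obs)

text \<open>Induction over the generated field. A generator depends on a single time, complements
  preserve the symmetric difference, and a countable union is first cut to a finite one, whose
  members then share the longest of finitely many memories.\<close>

lemma approximate_event:
  assumes "A \<in> sets \<F>0" and "0 < e"
  shows "\<exists>m\<le>0. \<exists>B\<in>sets (\<F> {m..0}). prob (sym_diff A B) < e"
proof -
  have "A \<in> sigma_sets (space M) (\<Union>k\<in>{..0}. (\<lambda>A. \<theta> (- k) ` A) ` sets Y)"
    using assms(1) by (simp add: sets_obs)
  then show ?thesis
    using assms(2)
  proof (induction arbitrary: e)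
    case (Basic A)
    then obtain k where k: "k \<le> 0" "A \<in> (\<lambda>A. \<theta> (- k) ` A) ` sets Y"
      by auto
    then have "A \<in> sets (\<F> {k..0})"
      unfolding sets_obs by (intro sigma_sets.Basic UN_I[of k]) auto
    then show ?case
      using k(1) Basic.prems by (intro exI[of _ k] conjI bexI[of _ A]) auto
  next
    case Empty
    then show ?case
      by (intro exI[of _ 0] conjI bexI[of _ "{}"]) auto
  next
    case (Compl A)
    then obtain m B where mB: "m \<le> 0" "B \<in> sets (\<F> {m..0})" "prob (sym_diff A B) < e"
      by blast
    have "A \<subseteq> space M"
      using Compl.hyps sigma_sets_into_sp[OF obs_generators] by blast
    moreover have "B \<subseteq> space M"
      using mB(2) sets.sets_into_space by (fastforce simp: space_obs)
    ultimately have "sym_diff (space M - A) (space M - B) = sym_diff A B"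
      by auto
    moreover have "space M - B \<in> sets (\<F> {m..0})"
      using sets.compl_sets[OF mB(2)] by (simp add: space_obs)
    ultimately show ?case
      using mB by (metis)
  next
    case (Union A)
    have A [measurable]: "A i \<in> sets M" for i
      using Union.hyps[of i] sets_obs_subset[of "A i" "{..0}"] by (simp add: sets_obs)
    have "(\<lambda>n. prob (\<Union>i<n. A i)) \<longlonglongrightarrow> prob (\<Union>n. \<Union>i<n. A i)"
    proof (rule finite_Lim_measure_incseq)
      show "incseq (\<lambda>n. \<Union>i<n. A i)"
        by (intro monoI UN_mono) auto
    qed auto
    moreover have "(\<Union>n. \<Union>i<n. A i) = (\<Union>i. A i)"
      by auto
    ultimately have "\<forall>\<^sub>F n in sequentially. prob (\<Union>i. A i) - e / 2 < prob (\<Union>i<n. A i)"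
      using Union.prems by (intro order_tendstoD(1)) auto
    then obtain n where n: "prob (\<Union>i. A i) - e / 2 < prob (\<Union>i<n. A i)"
      by (auto simp: eventually_sequentially)
    \<comment> \<open>Half of \<open>e\<close> pays for cutting off the union, and the other half is
      shared by the \<open>n\<close> approximations. Using \<open>Suc n\<close> keeps the share
      positive when \<open>n = 0\<close>.\<close>
    have "0 < e / (2 * real (Suc n))"
      using Union.prems by simp
    then have "\<forall>i. \<exists>m B. m \<le> 0 \<and> B \<in> sets (\<F> {m..0}) \<and> prob (sym_diff (A i) B) < e / (2 * real (Suc n))"
      using Union.IH by blast
    then obtain m B where mB: "\<And>i. m i \<le> 0" "\<And>i. B i \<in> sets (\<F> {m i..0})"
        "\<And>i. prob (sym_diff (A i) (B i)) < e / (2 * real (Suc n))"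
      by metis
    \<comment> \<open>The longest memory among the events \<open>B i\<close> that are used.
      Inserting 0 keeps the minimum meaningful when \<open>n = 0\<close>.\<close>
    define m0 where "m0 = Min (insert 0 (m ` {..<n}))"
    have "m0 \<le> 0" and m0: "m0 \<le> m i" if "i < n" for i
      using that by (auto simp: m0_def)
    have B [measurable]: "B i \<in> sets M" for i
      using mB(2) by (rule sets_obs_subset)
    have "B i \<in> sets (\<F> {m0..0})" if "i < n" for i
      using mB(2)[of i] sets_obs_mono[of "{m i..0}" "{m0..0}"] m0[OF that] by auto
    then have "(\<Union>i<n. B i) \<in> sets (\<F> {m0..0})"
      by auto
    moreover have "prob (sym_diff (\<Union>i. A i) (\<Union>i<n. B i)) < e"
    proof -
      have "prob (sym_diff (\<Union>i. A i) (\<Union>i<n. B i))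
          \<le> prob (((\<Union>i. A i) - (\<Union>i<n. A i)) \<union> (\<Union>i<n. sym_diff (A i) (B i)))"
        by (rule finite_measure_mono) auto
      also have "\<dots> \<le> prob ((\<Union>i. A i) - (\<Union>i<n. A i)) + prob (\<Union>i<n. sym_diff (A i) (B i))"
        by (rule measure_Un_le) auto
      also have "prob ((\<Union>i. A i) - (\<Union>i<n. A i)) = prob (\<Union>i. A i) - prob (\<Union>i<n. A i)"
        by (rule finite_measure_Diff) auto
      also have "prob (\<Union>i<n. sym_diff (A i) (B i)) \<le> (\<Sum>i<n. prob (sym_diff (A i) (B i)))"
        by (rule finite_measure_subadditive_finite) auto
      also have "(\<Sum>i<n. prob (sym_diff (A i) (B i))) \<le> (\<Sum>i<n. e / (2 * real (Suc n)))"
        using mB(3) by (intro sum_mono less_imp_le)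
      also have "\<dots> \<le> e / 2"
        using Union.prems by (simp add: field_simps)
      finally show ?thesis
        using n by linarith
    qed
    moreover have "m0 \<le> 0"
      by (simp add: m0_def)
    ultimately show ?case
      by blast
  qed
qed

text \<open>
  Unlike \<open>\<U>0\<close>, this class is closed under pasting along events of \<open>\<F>0\<close>.
\<close>

definition approx_decisions :: "('a \<Rightarrow> 'u) set" where
  "approx_decisions = {w \<in> \<F>0 \<rightarrow>\<^sub>M U. \<forall>e>0. \<exists>u\<in>\<U>0. \<exists>B\<in>sets M.
     prob B < e \<and> (\<forall>\<omega>\<in>space M. \<omega> \<notin> B \<longrightarrow> u \<omega> = w \<omega>)}"

lemma approx_decisions_measurable: "w \<in> approx_decisions \<Longrightarrow> w \<in> M \<rightarrow>\<^sub>M U"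
  unfolding approx_decisions_def by (auto intro: measurable_obs_M)

lemma decisions_upto_approx: "\<U>0 \<subseteq> approx_decisions"
  unfolding approx_decisions_def
  by (auto intro: decisions_upto_measurable_\<F>0 intro!: bexI[of _ "{}"])

text \<open>The two decisions and the event are each replaced by a finite-memory version, at the
  cost of an exceptional event of probability below \<open>e / 3\<close>. The pasted versions have
  finite memory and agree with the given paste off the union of the three exceptional
  events.\<close>

lemma approx_decisions_paste:
  assumes w: "w \<in> approx_decisions" "w' \<in> approx_decisions" and A: "A \<in> sets \<F>0"
  shows "(\<lambda>\<omega>. if \<omega> \<in> A then w \<omega> else w' \<omega>) \<in> approx_decisions"
  unfolding approx_decisions_def
proof (intro CollectI conjI allI impI)
  have [measurable]: "w \<in> \<F>0 \<rightarrow>\<^sub>M U" "w' \<in> \<F>0 \<rightarrow>\<^sub>M U"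
    using w by (auto simp: approx_decisions_def)
  note A [measurable]
  show "(\<lambda>\<omega>. if \<omega> \<in> A then w \<omega> else w' \<omega>) \<in> \<F>0 \<rightarrow>\<^sub>M U"
    by measurable
  fix e :: real assume e: "0 < e"
  then have e3: "0 < e / 3"
    by simp
  obtain u B where u: "u \<in> \<U>0" "B \<in> sets M" "prob B < e / 3" "\<And>\<omega>. \<omega> \<in> space M \<Longrightarrow> \<omega> \<notin> B \<Longrightarrow> u \<omega> = w \<omega>"
    using w(1) e3 unfolding approx_decisions_def by blast
  obtain u' B' where u': "u' \<in> \<U>0" "B' \<in> sets M" "prob B' < e / 3" "\<And>\<omega>. \<omega> \<in> space M \<Longrightarrow> \<omega> \<notin> B' \<Longrightarrow> u' \<omega> = w' \<omega>"
    using w(2) e3 unfolding approx_decisions_def by blast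
  obtain m C where C: "m \<le> 0" "C \<in> sets (\<F> {m..0})" "prob (sym_diff A C) < e / 3"
    using approximate_event[OF A e3] by blast
  obtain p p' where p: "p \<le> 0" "u \<in> decisions M Y T U p 0" "p' \<le> 0" "u' \<in> decisions M Y T U p' 0"
    using u(1) u'(1) by (auto simp: decisions_upto_def)
  \<comment> \<open>A common starting time for the memories of \<open>u\<close>, \<open>u'\<close>
    and \<open>C\<close>.\<close>
  define q where "q = min m (min p p')"
  have [measurable]: "u \<in> \<F> {q..0} \<rightarrow>\<^sub>M U" "u' \<in> \<F> {q..0} \<rightarrow>\<^sub>M U"
  proof -
    have "q \<le> p" "q \<le> p'"
      by (auto simp: q_def)
    from decisions_mono[OF this(1), of 0] decisions_mono[OF this(2), of 0] p(2,4)
    show "u \<in> \<F> {q..0} \<rightarrow>\<^sub>M U" "u' \<in> \<F> {q..0} \<rightarrow>\<^sub>M U"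
      by (auto simp: decisions_def)
  qed
  have [measurable]: "C \<in> sets (\<F> {q..0})"
    using C(2) sets_obs_mono[of "{m..0}" "{q..0}"] by (auto simp: q_def)
  have "(\<lambda>\<omega>. if \<omega> \<in> C then u \<omega> else u' \<omega>) \<in> \<F> {q..0} \<rightarrow>\<^sub>M U"
    by measurable
  then have paste: "(\<lambda>\<omega>. if \<omega> \<in> C then u \<omega> else u' \<omega>) \<in> \<U>0"
    using p C by (auto simp: decisions_upto_def decisions_def q_def)
  have [measurable]: "A \<in> sets M" "C \<in> sets M"
    using sets_obs_subset[OF A] sets_obs_subset[OF C(2)] by auto
  have "prob (sym_diff A C \<union> (B \<union> B')) \<le> prob (sym_diff A C) + (prob B + prob B')"
    using u(2) u'(2)
    by (intro order.trans[OF measure_Un_le] add_left_mono measure_Un_le) auto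
  also have "\<dots> < e"
    using u(3) u'(3) C(3) by linarith
  finally have "prob (sym_diff A C \<union> (B \<union> B')) < e" .
  then show "\<exists>u\<in>\<U>0. \<exists>B\<in>sets M. prob B < e \<and>
      (\<forall>\<omega>\<in>space M. \<omega> \<notin> B \<longrightarrow> u \<omega> = (if \<omega> \<in> A then w \<omega> else w' \<omega>))"
    using u(2,4) u'(2,4) by (intro bexI[OF _ paste] bexI[of _ "sym_diff A C \<union> (B \<union> B')"]) auto
qed

text \<open>Enlarging the class does not lower the infimum of expected losses: \<open>w\<close>
  differs from some finite-memory decision only on an event \<open>B\<close> of small probability,
  the losses there differ by at most \<open>2 * \<Lambda> \<omega>\<close>, and the integral of
  \<open>\<Lambda>\<close> over \<open>B\<close> is small by absolute continuity.\<close>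

lemma approx_decisions_lower_bound:
  assumes w: "w \<in> approx_decisions" and I: "\<And>u. u \<in> \<U>0 \<Longrightarrow> I \<le> expectation (loss0 u)"
  shows "I \<le> expectation (loss0 w)"
proof (rule field_le_epsilon)
  fix e :: real assume "0 < e"
  then have "0 < e / 2"
    by simp
  obtain d where d: "0 < d" "\<And>B. B \<in> sets M \<Longrightarrow> prob B < d \<Longrightarrow> expectation (\<lambda>x. \<Lambda> x * indicator B x) < e / 2"
    using absolute_continuity_integral[OF integrable_\<Lambda> \<Lambda>_nonneg \<open>0 < e / 2\<close>] by blast
  obtain u B where u: "u \<in> \<U>0" "B \<in> sets M" "prob B < d" "\<And>\<omega>. \<omega> \<in> space M \<Longrightarrow> \<omega> \<notin> B \<Longrightarrow> u \<omega> = w \<omega>"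
    using w d(1) unfolding approx_decisions_def by blast
  note meas = approx_decisions_measurable[OF w] decisions_upto_measurable[OF u(1)]
  have int: "integrable M (\<lambda>\<omega>. \<Lambda> \<omega> * indicator B \<omega>)"
    using u(2) integrable_\<Lambda> by (intro integrable_real_mult_indicator)
  have "expectation (loss0 u) \<le> expectation (\<lambda>\<omega>. loss0 w \<omega> + 2 * (\<Lambda> \<omega> * indicator B \<omega>))"
  proof (rule integral_mono)
    show "integrable M (loss0 u)" "integrable M (\<lambda>\<omega>. loss0 w \<omega> + 2 * (\<Lambda> \<omega> * indicator B \<omega>))"
      using integrable_loss meas int by auto
    fix \<omega> assume \<omega>: "\<omega> \<in> space M"
    show "loss0 u \<omega> \<le> loss0 w \<omega> + 2 * (\<Lambda> \<omega> * indicator B \<omega>)"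
    proof (cases "\<omega> \<in> B")
      case True
      then show ?thesis
        using loss0_bound[OF meas(1) \<omega>] loss0_bound[OF meas(2) \<omega>] by (simp add: abs_le_iff)
    next
      case False
      then show ?thesis
        using u(4)[OF \<omega>] by (simp add: loss_def)
    qed
  qed
  also have "\<dots> = expectation (loss0 w) + 2 * expectation (\<lambda>\<omega>. \<Lambda> \<omega> * indicator B \<omega>)"
    using integrable_loss[OF meas(1)] int by simp
  also have "\<dots> \<le> expectation (loss0 w) + e"
    using d(2)[OF u(2,3)] by simp
  finally show "I \<le> expectation (loss0 w) + e"
    using I[OF u(1)] by linarith
qed

lemma cond0_loss_bound:
  assumes "u \<in> M \<rightarrow>\<^sub>M U"
  shows "AE \<omega> in M. \<bar>cond0 (loss0 u) \<omega>\<bar> \<le> cond0 \<Lambda> \<omega>"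
  using integrable_loss[OF assms] integrable_\<Lambda> loss0_bound[OF assms]
  by (intro F0.abs_real_cond_exp_le AE_I2)

text \<open>Conditional losses are measurable for \<open>\<F>0\<close>, so the event where
  \<open>w\<close> is at least as good as \<open>w'\<close> belongs to \<open>\<F>0\<close>. Pasting
  along it realises the minimum, since indicators of such events pull out of the conditional
  expectation. The conditional losses are thus directed downwards.\<close>

lemma approx_decisions_min:
  assumes w: "w \<in> approx_decisions" "w' \<in> approx_decisions"
  shows "\<exists>w''\<in>approx_decisions. AE \<omega> in M.
    cond0 (loss0 w'') \<omega> = min (cond0 (loss0 w) \<omega>) (cond0 (loss0 w') \<omega>)"
proof -
  define A where "A = {\<omega> \<in> space \<F>0. cond0 (loss0 w) \<omega> \<le> cond0 (loss0 w') \<omega>}"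
  define w'' where "w'' \<omega> = (if \<omega> \<in> A then w \<omega> else w' \<omega>)" for \<omega>
  have A [measurable]: "A \<in> sets \<F>0"
    unfolding A_def by measurable
  then have A' [measurable]: "A \<in> sets M"
    by (rule sets_obs_subset)
  have w'': "w'' \<in> approx_decisions"
    unfolding w''_def using w A by (rule approx_decisions_paste)
  note int = integrable_loss[OF approx_decisions_measurable[OF w(1)], of 0]
    integrable_loss[OF approx_decisions_measurable[OF w(2)], of 0]
  note [measurable] = borel_measurable_integrable[OF int(1)] borel_measurable_integrable[OF int(2)]
  let ?i = "indicator A :: 'a \<Rightarrow> real"
  have i1: "integrable M (\<lambda>\<omega>. ?i \<omega> * loss0 w \<omega>)"
    using integrable_real_mult_indicator[OF A' int(1)] by (simp add: mult.commute)
  have i2: "integrable M (\<lambda>\<omega>. (1 - ?i \<omega>) * loss0 w' \<omega>)"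
    using integrable_real_mult_indicator[OF A' int(2)] int(2) by (simp add: algebra_simps)
  have eq: "loss0 w'' = (\<lambda>\<omega>. ?i \<omega> * loss0 w \<omega> + (1 - ?i \<omega>) * loss0 w' \<omega>)"
    by (auto simp: fun_eq_iff loss_def w''_def indicator_def)
  have "AE \<omega> in M. cond0 (loss0 w'') \<omega>
      = cond0 (\<lambda>\<omega>. ?i \<omega> * loss0 w \<omega>) \<omega> + cond0 (\<lambda>\<omega>. (1 - ?i \<omega>) * loss0 w' \<omega>) \<omega>"
    unfolding eq using i1 i2 by (rule F0.real_cond_exp_add)
  moreover have "AE \<omega> in M. cond0 (\<lambda>\<omega>. ?i \<omega> * loss0 w \<omega>) \<omega> = ?i \<omega> * cond0 (loss0 w) \<omega>"
    by (rule F0.real_cond_exp_mult[OF _ _ i1]) auto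
  moreover have "AE \<omega> in M. cond0 (\<lambda>\<omega>. (1 - ?i \<omega>) * loss0 w' \<omega>) \<omega> = (1 - ?i \<omega>) * cond0 (loss0 w') \<omega>"
    by (rule F0.real_cond_exp_mult[OF _ _ i2]) auto
  ultimately have "AE \<omega> in M. cond0 (loss0 w'') \<omega> = min (cond0 (loss0 w) \<omega>) (cond0 (loss0 w') \<omega>)"
    using AE_space
  proof eventually_elim
    case (elim \<omega>)
    then show ?case
      by (auto simp: A_def space_obs indicator_def min_def)
  qed
  with w'' show ?thesis
    by blast
qed

section \<open>The essential infimum of the conditional losses\<close>

definition cond_value :: "'a \<Rightarrow> ereal" where
  "cond_value = ess_Inf M {\<lambda>\<omega>. ereal (cond0 (loss0 u) \<omega>) | u. u \<in> \<U>0}"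

lemma is_ess_Inf_cond_value:
  "is_ess_Inf M {\<lambda>\<omega>. ereal (cond0 (loss0 u) \<omega>) | u. u \<in> \<U>0} cond_value"
  unfolding cond_value_def by (rule is_ess_Inf_ess_Inf) auto

lemma cond_value_measurable [measurable]: "cond_value \<in> borel_measurable M"
  using is_ess_Inf_cond_value by (simp add: is_ess_Inf_def)

lemma cond_value_le:
  assumes "u \<in> \<U>0"
  shows "AE \<omega> in M. cond_value \<omega> \<le> ereal (cond0 (loss0 u) \<omega>)"
  using is_ess_Inf_cond_value[unfolded is_ess_Inf_def, THEN conjunct2, THEN conjunct1] assms by auto

lemma cond_value_ge:
  assumes [measurable]: "h \<in> borel_measurable M"
    and h: "\<And>u. u \<in> \<U>0 \<Longrightarrow> AE \<omega> in M. h \<omega> \<le> cond0 (loss0 u) \<omega>"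
  shows "AE \<omega> in M. ereal (h \<omega>) \<le> cond_value \<omega>"
proof -
  have "\<forall>f\<in>{\<lambda>\<omega>. ereal (cond0 (loss0 u) \<omega>) | u. u \<in> \<U>0}. AE \<omega> in M. ereal (h \<omega>) \<le> f \<omega>"
    using h by auto
  moreover have "(\<lambda>\<omega>. ereal (h \<omega>)) \<in> borel_measurable M"
    by measurable
  ultimately show ?thesis
    using is_ess_Inf_cond_value[unfolded is_ess_Inf_def, THEN conjunct2, THEN conjunct2, THEN bspec, THEN mp]
    by simp
qed

lemma cond_value_bound: "AE \<omega> in M. \<bar>cond_value \<omega>\<bar> \<le> ereal (cond0 \<Lambda> \<omega>)"
proof -
  obtain u where u: "u \<in> \<U>0"
    using decisions_upto_nonempty by auto
  have "AE \<omega> in M. ereal (- cond0 \<Lambda> \<omega>) \<le> cond_value \<omega>"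
  proof (rule cond_value_ge)
    fix u assume "u \<in> \<U>0"
    from cond0_loss_bound[OF decisions_upto_measurable[OF this]]
    show "AE \<omega> in M. - cond0 \<Lambda> \<omega> \<le> cond0 (loss0 u) \<omega>"
      by eventually_elim auto
  qed measurable
  then show ?thesis
    using cond_value_le[OF u] cond0_loss_bound[OF decisions_upto_measurable[OF u]]
  proof eventually_elim
    case (elim \<omega>)
    then show ?case
      by (cases "cond_value \<omega>") auto
  qed
qed

text \<open>The conversion changes nothing almost surely: \<open>cond_value\<close> lies between
  \<open>- cond0 \<Lambda>\<close> and \<open>cond0 \<Lambda>\<close> and is therefore finite. This
  is the function \<open>V\<close> of the overview.\<close>

definition real_value :: "'a \<Rightarrow> real" where
  "real_value \<omega> = real_of_ereal (cond_value \<omega>)"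

lemma cond_value_eq: "AE \<omega> in M. cond_value \<omega> = ereal (real_value \<omega>)"
  using cond_value_bound
proof eventually_elim
  case (elim \<omega>)
  then show ?case
    by (cases "cond_value \<omega>") (auto simp: real_value_def)
qed

lemma integrable_real_value: "integrable M real_value"
proof (rule Bochner_Integration.integrable_bound)
  show "integrable M (cond0 \<Lambda>)"
    using integrable_\<Lambda> by (rule F0.real_cond_exp_int)
  show "real_value \<in> borel_measurable M"
    unfolding real_value_def[abs_def] by measurable
  show "AE \<omega> in M. norm (real_value \<omega>) \<le> norm (cond0 \<Lambda> \<omega>)"
    using cond_value_bound cond_value_eq by eventually_elim auto
qed

lemma optimal_loss_eq: "optimal_loss M Y T U l = expectation real_value"
  by (simp add: optimal_loss_def real_value_def [abs_def] cond_value_def)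

lemma real_value_le:
  assumes "u \<in> \<U>0"
  shows "AE \<omega> in M. real_value \<omega> \<le> cond0 (loss0 u) \<omega>"
  using cond_value_le[OF assms] cond_value_eq by eventually_elim auto

section \<open>Minimizing sequences of decisions\<close>

lemma bdd_below_expectation_loss: "bdd_below ((\<lambda>w. expectation (loss0 w)) ` approx_decisions)"
proof (rule bdd_belowI2)
  fix w assume "w \<in> approx_decisions"
  note w = approx_decisions_measurable[OF this]
  show "expectation (\<lambda>\<omega>. - \<Lambda> \<omega>) \<le> expectation (loss0 w)"
    using integrable_\<Lambda> integrable_loss[OF w] loss0_bound[OF w]
    by (intro integral_mono) (auto simp: abs_le_iff minus_le_iff)
qed

text \<open>Each new near-minimizer is replaced by its minimum with the preceding member. This makes
  the conditional losses decrease and can only improve the expected loss.\<close>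

lemma ex_decreasing_minimizing_sequence:
  assumes I: "I = (INF w\<in>approx_decisions. expectation (loss0 w))"
  shows "\<exists>w. \<forall>n::nat. w n \<in> approx_decisions \<and> expectation (loss0 (w n)) \<le> I + 1 / real (Suc n)
    \<and> (AE \<omega> in M. cond0 (loss0 (w (Suc n))) \<omega> \<le> cond0 (loss0 (w n)) \<omega>)"
proof -
  have ne: "approx_decisions \<noteq> {}"
    using decisions_upto_nonempty decisions_upto_approx by auto
  have near: "\<exists>w\<in>approx_decisions. expectation (loss0 w) < I + 1 / real (Suc n)" for n
    using cINF_less_iff[OF ne bdd_below_expectation_loss, of "I + 1 / real (Suc n)"] by (simp add: I)
  have "\<exists>w. \<forall>n. (w n \<in> approx_decisions \<and> expectation (loss0 (w n)) \<le> I + 1 / real (Suc n))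
      \<and> (AE \<omega> in M. cond0 (loss0 (w (Suc n))) \<omega> \<le> cond0 (loss0 (w n)) \<omega>)"
  proof (rule dependent_nat_choice)
    show "\<exists>w. w \<in> approx_decisions \<and> expectation (loss0 w) \<le> I + 1 / real (Suc 0)"
      using near[of 0] by (auto intro: less_imp_le)
  next
    fix w and n :: nat
    assume w: "w \<in> approx_decisions \<and> expectation (loss0 w) \<le> I + 1 / real (Suc n)"
    obtain w' where w': "w' \<in> approx_decisions" "expectation (loss0 w') < I + 1 / real (Suc (Suc n))"
      using near by blast
    obtain z where z: "z \<in> approx_decisions"
        "AE \<omega> in M. cond0 (loss0 z) \<omega> = min (cond0 (loss0 w) \<omega>) (cond0 (loss0 w') \<omega>)"
      using approx_decisions_min w w'(1) by blast
    note int = integrable_loss[OF approx_decisions_measurable, of _ 0]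
    have "expectation (loss0 z) = expectation (cond0 (loss0 z))"
      using int[OF z(1)] by (rule F0.real_cond_exp_int(2)[symmetric])
    also have "\<dots> \<le> expectation (cond0 (loss0 w'))"
      using z(2) int[OF z(1)] int[OF w'(1)]
      by (intro integral_mono_AE F0.real_cond_exp_int(1)) auto
    also have "\<dots> = expectation (loss0 w')"
      using int[OF w'(1)] by (rule F0.real_cond_exp_int(2))
    finally have "expectation (loss0 z) \<le> I + 1 / real (Suc (Suc n))"
      using w'(2) by linarith
    moreover have "AE \<omega> in M. cond0 (loss0 z) \<omega> \<le> cond0 (loss0 w) \<omega>"
      using z(2) by eventually_elim auto
    ultimately show "\<exists>z. (z \<in> approx_decisions \<and> expectation (loss0 z) \<le> I + 1 / real (Suc (Suc n)))
        \<and> (AE \<omega> in M. cond0 (loss0 z) \<omega> \<le> cond0 (loss0 w) \<omega>)"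
      using z(1) by blast
  qed
  then show ?thesis
    by blast
qed

text \<open>The conditional losses along a decreasing minimizing sequence converge to some
  \<open>Zlim\<close> with \<open>I \<le> expectation Zlim\<close>. Almost surely
  \<open>Zlim\<close> lies below the conditional loss of every \<open>u\<close> in
  \<open>\<U>0\<close>, for otherwise taking minima with that loss would push expectations below
  \<open>I\<close>. Hence \<open>Zlim\<close> lies below \<open>real_value\<close>, whose
  expectation is the optimal loss.\<close>

lemma INF_approx_decisions_le:
  "(INF w\<in>approx_decisions. expectation (loss0 w)) \<le> optimal_loss M Y T U l"
proof -
  define I where "I = (INF w\<in>approx_decisions. expectation (loss0 w))"
  have I_le: "I \<le> expectation (loss0 w)" if "w \<in> approx_decisions" for w
    unfolding I_def using bdd_below_expectation_loss that by (rule cINF_lower)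
  obtain w where w: "\<And>n::nat. w n \<in> approx_decisions"
      "\<And>n. expectation (loss0 (w n)) \<le> I + 1 / real (Suc n)"
      "\<And>n. AE \<omega> in M. cond0 (loss0 (w (Suc n))) \<omega> \<le> cond0 (loss0 (w n)) \<omega>"
    using ex_decreasing_minimizing_sequence[OF I_def] by blast
  define Z where "Z n = cond0 (loss0 (w n))" for n
  have [measurable]: "Z n \<in> borel_measurable M" for n
    by (simp add: Z_def)
  note int = integrable_loss[OF approx_decisions_measurable, of _ 0]
  have Z_int: "integrable M (Z n)" and Z_exp: "expectation (Z n) = expectation (loss0 (w n))" for n
    unfolding Z_def using int[OF w(1)] by (rule F0.real_cond_exp_int)+
  \<comment> \<open>Where the sequence diverges, \<open>lim\<close> is an unspecified value; this
    affects a null set only.\<close>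
  define Zlim where "Zlim \<omega> = lim (\<lambda>n. Z n \<omega>)" for \<omega>
  have [measurable]: "Zlim \<in> borel_measurable M"
    unfolding Zlim_def by measurable
  have "AE \<omega> in M. \<forall>n. Z (Suc n) \<omega> \<le> Z n \<omega>"
    using w(3) by (simp add: AE_all_countable Z_def)
  moreover have Z_bound: "AE \<omega> in M. \<forall>n. \<bar>Z n \<omega>\<bar> \<le> cond0 \<Lambda> \<omega>"
    using cond0_loss_bound[OF approx_decisions_measurable[OF w(1)]] by (simp add: AE_all_countable Z_def)
  ultimately have lim: "AE \<omega> in M. (\<lambda>n. Z n \<omega>) \<longlonglongrightarrow> Zlim \<omega> \<and> (\<forall>n. Zlim \<omega> \<le> Z n \<omega>)"
  proof eventually_elim
    case (elim \<omega>)
    then have dec: "decseq (\<lambda>n. Z n \<omega>)"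
      by (auto intro: decseq_SucI)
    have "- cond0 \<Lambda> \<omega> \<le> Z n \<omega>" for n
      using elim(2)[rule_format, of n] by (simp add: abs_le_iff)
    then obtain L where "(\<lambda>n. Z n \<omega>) \<longlonglongrightarrow> L"
      using decseq_convergent[OF dec] by metis
    then have "(\<lambda>n. Z n \<omega>) \<longlonglongrightarrow> Zlim \<omega>"
      by (simp add: Zlim_def limI)
    then show ?case
      using decseq_ge[OF dec] by blast
  qed
  have \<Lambda>_int: "integrable M (cond0 \<Lambda>)"
    using integrable_\<Lambda> by (rule F0.real_cond_exp_int)
  have conv: "integrable M Zlim" "(\<lambda>n. expectation (Z n)) \<longlonglongrightarrow> expectation Zlim"
  proof -
    have lim': "AE \<omega> in M. (\<lambda>n. Z n \<omega>) \<longlonglongrightarrow> Zlim \<omega>"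
      using lim by eventually_elim auto
    have bound: "AE \<omega> in M. norm (Z n \<omega>) \<le> cond0 \<Lambda> \<omega>" for n
      using Z_bound by eventually_elim auto
    show "integrable M Zlim"
      by (rule integrable_dominated_convergence[OF _ _ \<Lambda>_int lim' bound]) auto
    show "(\<lambda>n. expectation (Z n)) \<longlonglongrightarrow> expectation Zlim"
      by (rule integral_dominated_convergence[OF _ _ \<Lambda>_int lim' bound]) auto
  qed
  have "I \<le> expectation Zlim"
    using conv(2) I_le[OF w(1)] by (intro LIMSEQ_le_const) (auto simp: Z_exp)
  have "AE \<omega> in M. Zlim \<omega> \<le> cond0 (loss0 u) \<omega>" if u: "u \<in> \<U>0" for u
  proof -
    have uW: "u \<in> approx_decisions"
      using u decisions_upto_approx by auto
    define f where "f = cond0 (loss0 u)"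
    have f_int: "integrable M f"
      unfolding f_def using int[OF uW] by (rule F0.real_cond_exp_int)
    have "expectation (\<lambda>\<omega>. max (Zlim \<omega> - f \<omega>) 0) \<le> 1 / real (Suc n)" for n
    proof -
      obtain z where z: "z \<in> approx_decisions" "AE \<omega> in M. cond0 (loss0 z) \<omega> = min (Z n \<omega>) (f \<omega>)"
        using approx_decisions_min[OF w(1)[of n] uW] unfolding Z_def f_def by blast
      have "I \<le> expectation (cond0 (loss0 z))"
        using I_le[OF z(1)] F0.real_cond_exp_int(2)[OF int[OF z(1)]] by simp
      also have "\<dots> = expectation (\<lambda>\<omega>. min (Z n \<omega>) (f \<omega>))"
        using z(2) f_int by (intro integral_cong_AE) auto
      finally have I_min: "I \<le> expectation (\<lambda>\<omega>. min (Z n \<omega>) (f \<omega>))" .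
      \<comment> \<open>As \<open>Zlim\<close> lies below \<open>Z n\<close>, the excess of
        \<open>Zlim\<close> over \<open>f\<close> is at most what is lost in replacing
        \<open>Z n\<close> by its minimum with \<open>f\<close>. That loss has expectation at most
        \<open>1 / real (Suc n)\<close>, because \<open>Z n\<close> is this close to the infimum and
        the minimum cannot go below it.\<close>
      have "expectation (\<lambda>\<omega>. max (Zlim \<omega> - f \<omega>) 0) \<le> expectation (\<lambda>\<omega>. Z n \<omega> - min (Z n \<omega>) (f \<omega>))"
      proof (rule integral_mono_AE)
        show "AE \<omega> in M. max (Zlim \<omega> - f \<omega>) 0 \<le> Z n \<omega> - min (Z n \<omega>) (f \<omega>)"
          using lim
        proof eventually_elim
          case (elim \<omega>)
          then have "Zlim \<omega> \<le> Z n \<omega>"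
            by blast
          then show ?case
            by (simp add: max_def min_def)
        qed
      qed (use conv(1) f_int Z_int in auto)
      also have "\<dots> = expectation (Z n) - expectation (\<lambda>\<omega>. min (Z n \<omega>) (f \<omega>))"
        using f_int Z_int by simp
      also have "\<dots> \<le> 1 / real (Suc n)"
        using I_min w(2)[of n] by (simp add: Z_exp)
      finally show ?thesis .
    qed
    then have "expectation (\<lambda>\<omega>. max (Zlim \<omega> - f \<omega>) 0) \<le> 0"
      by (intro LIMSEQ_le_const[OF LIMSEQ_Suc[OF lim_1_over_n]]) auto
    moreover have "0 \<le> expectation (\<lambda>\<omega>. max (Zlim \<omega> - f \<omega>) 0)"
      by (intro integral_nonneg_AE) auto
    ultimately have "AE \<omega> in M. max (Zlim \<omega> - f \<omega>) 0 = 0"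
      using conv(1) f_int by (subst integral_nonneg_eq_0_iff_AE[symmetric]) auto
    then show ?thesis
      unfolding f_def[symmetric] by eventually_elim (auto simp: max_def split: if_splits)
  qed
  then have "AE \<omega> in M. ereal (Zlim \<omega>) \<le> cond_value \<omega>"
    by (intro cond_value_ge) auto
  then have "AE \<omega> in M. Zlim \<omega> \<le> real_value \<omega>"
    using cond_value_eq by eventually_elim auto
  then have "expectation Zlim \<le> expectation real_value"
    using conv(1) integrable_real_value by (intro integral_mono_AE) auto
  with \<open>I \<le> expectation Zlim\<close> show ?thesis
    by (simp add: optimal_loss_eq I_def)
qed

text \<open>If every finite-memory decision cost at least \<open>e\<close> more than the optimal
  loss, so would every decision in \<open>approx_decisions\<close>, and their infimum would exceed
  the optimal loss.\<close>

lemma ex_near_optimal_decision: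
  assumes "0 < e"
  shows "\<exists>u\<in>\<U>0. expectation (loss0 u) \<le> optimal_loss M Y T U l + e"
proof (rule ccontr)
  assume "\<not> ?thesis"
  then have no: "optimal_loss M Y T U l + e \<le> expectation (loss0 u)" if "u \<in> \<U>0" for u
    using that linorder_linear by blast
  have "optimal_loss M Y T U l + e \<le> expectation (loss0 w)" if "w \<in> approx_decisions" for w
    using that no by (rule approx_decisions_lower_bound)
  moreover have "approx_decisions \<noteq> {}"
    using decisions_upto_nonempty decisions_upto_approx by auto
  ultimately have "optimal_loss M Y T U l + e \<le> (INF w\<in>approx_decisions. expectation (loss0 w))"
    by (intro cINF_greatest)
  then show False
    using INF_approx_decisions_le assms by linarith
qed

section \<open>Covariances of centered losses\<close>

abbreviation "truncated_loss B u \<equiv> \<lambda>\<omega>. loss0 u \<omega> * indicator {\<omega>. \<Lambda> \<omega> \<le> B} \<omega>"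

abbreviation "centered B u \<equiv> centered_loss M Y T l \<Lambda> B u"

text \<open>Where the indicator is 1, \<open>\<Lambda> \<omega>\<close> is at most \<open>B\<close>.
  The absolute value covers negative \<open>B\<close>, for which the truncated loss
  vanishes.\<close>

lemma truncated_loss_bound:
  assumes "u \<in> M \<rightarrow>\<^sub>M U" "\<omega> \<in> space M"
  shows "\<bar>truncated_loss B u \<omega>\<bar> \<le> \<bar>B\<bar>"
  using loss0_bound[OF assms] by (auto simp: indicator_def)

lemma integrable_truncated_loss:
  assumes [measurable]: "u \<in> M \<rightarrow>\<^sub>M U"
  shows "integrable M (truncated_loss B u)"
  using truncated_loss_bound[OF assms] by (intro integrable_const_bound[of _ "\<bar>B\<bar>"]) auto

lemma centered_measurable [measurable]:
  assumes [measurable]: "u \<in> M \<rightarrow>\<^sub>M U"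
  shows "centered B u \<in> borel_measurable M"
  unfolding centered_loss_def[abs_def] by measurable

lemma centered_bound:
  assumes u: "u \<in> M \<rightarrow>\<^sub>M U"
  shows "AE \<omega> in M. \<bar>centered B u \<omega>\<bar> \<le> 2 * \<bar>B\<bar>"
proof -
  have "AE \<omega> in M. cond0 (truncated_loss B u) \<omega> \<le> \<bar>B\<bar>"
    using truncated_loss_bound[OF u, of _ B]
    by (intro F0.real_cond_exp_le_c integrable_truncated_loss u AE_I2) (simp add: abs_le_iff)
  moreover have "AE \<omega> in M. - \<bar>B\<bar> \<le> cond0 (truncated_loss B u) \<omega>"
    using truncated_loss_bound[OF u, of _ B]
    by (intro F0.real_cond_exp_ge_c integrable_truncated_loss u AE_I2) (simp add: abs_le_iff minus_le_iff)
  ultimately show ?thesis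
    using AE_space
  proof eventually_elim
    case (elim \<omega>)
    then show ?case
      using truncated_loss_bound[OF u, of \<omega> B] unfolding centered_loss_def by linarith
  qed
qed

lemma centered_product_bound:
  assumes u: "u \<in> M \<rightarrow>\<^sub>M U" and u': "u' \<in> M \<rightarrow>\<^sub>M U"
  shows "AE \<omega> in M. \<bar>centered B u (\<theta> k \<omega>) * centered B u' \<omega>\<bar> \<le> 4 * B\<^sup>2"
  using AE_tpow[OF centered_bound[OF u, of B], of k] centered_bound[OF u', of B]
proof eventually_elim
  case (elim \<omega>)
  then have "\<bar>centered B u (\<theta> k \<omega>)\<bar> * \<bar>centered B u' \<omega>\<bar> \<le> (2 * \<bar>B\<bar>) * (2 * \<bar>B\<bar>)"
    by (intro mult_mono) auto
  then show ?case
    by (simp add: abs_mult power2_eq_square)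
qed

lemma integrable_centered_product:
  assumes u: "u \<in> M \<rightarrow>\<^sub>M U" and u': "u' \<in> M \<rightarrow>\<^sub>M U"
  shows "integrable M (\<lambda>\<omega>. centered B u (\<theta> k \<omega>) * centered B u' \<omega>)"
proof (rule integrable_const_bound[of _ "4 * B\<^sup>2"])
  note [measurable] = u u'
  show "(\<lambda>\<omega>. centered B u (\<theta> k \<omega>) * centered B u' \<omega>) \<in> borel_measurable M"
    by measurable
qed (use centered_product_bound[OF u u'] in simp)

lemma integrable_centered:
  assumes u: "u \<in> M \<rightarrow>\<^sub>M U"
  shows "integrable M (centered B u)"
  using centered_bound[OF u] u by (intro integrable_const_bound[of _ "2 * \<bar>B\<bar>"]) auto

section \<open>Truncation errors, uniform in the decision\<close>

definition tail :: "real \<Rightarrow> real" where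
  "tail B = expectation (\<lambda>\<omega>. \<bar>\<Lambda> \<omega>\<bar> * indicator {\<omega>. B < \<Lambda> \<omega>} \<omega>)"

lemma tail_tendsto_zero: "(tail \<longlongrightarrow> 0) at_top"
  unfolding tail_def[abs_def] using integrable_\<Lambda> by (rule integral_tail_tendsto_zero)

lemma tail_nonneg: "0 \<le> tail B"
  unfolding tail_def by (intro integral_nonneg_AE AE_I2) auto

text \<open>The part of the loss not predicted by the infinite past: its conditional expectation
  given \<open>\<F>0\<close> is almost surely 0.\<close>

abbreviation "innovation u \<equiv> \<lambda>\<omega>. loss0 u \<omega> - cond0 (loss0 u) \<omega>"

lemma integrable_innovation:
  assumes u: "u \<in> M \<rightarrow>\<^sub>M U"
  shows "integrable M (innovation u)"
  using integrable_loss[OF u, of 0] by (intro Bochner_Integration.integrable_diff F0.real_cond_exp_int(1))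

text \<open>The difference is \<open>r\<close> minus its conditional expectation, where
  \<open>r\<close> is the part of the loss cut off, dominated by \<open>\<Lambda>\<close> on the
  event that \<open>\<Lambda>\<close> exceeds \<open>B\<close>. The conditional expectation of the
  dominating function has the same integral, whence the factor 2.\<close>

lemma truncation_error:
  assumes u: "u \<in> M \<rightarrow>\<^sub>M U"
  shows "expectation (\<lambda>\<omega>. \<bar>innovation u \<omega> - centered B u \<omega>\<bar>) \<le> 2 * tail B"
proof -
  define t where "t \<omega> = \<bar>\<Lambda> \<omega>\<bar> * indicator {\<omega>. B < \<Lambda> \<omega>} \<omega>" for \<omega>
  define r where "r \<omega> = loss0 u \<omega> - truncated_loss B u \<omega>" for \<omega>
  have t: "integrable M t"
    unfolding t_def using integrable_\<Lambda>
    by (rule Bochner_Integration.integrable_bound) (auto simp: indicator_def)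
  have r: "integrable M r"
    unfolding r_def using integrable_loss[OF u, of 0] integrable_truncated_loss[OF u] by auto
  have rt: "\<bar>r \<omega>\<bar> \<le> t \<omega>" if "\<omega> \<in> space M" for \<omega>
    using loss0_bound[OF u that] by (auto simp: r_def t_def indicator_def)
  have ct: "integrable M (cond0 t)" "expectation (cond0 t) = expectation t"
    using t by (rule F0.real_cond_exp_int)+
  have "AE \<omega> in M. \<bar>cond0 r \<omega>\<bar> \<le> cond0 t \<omega>"
    using r t rt by (intro F0.abs_real_cond_exp_le AE_I2)
  moreover have "AE \<omega> in M. cond0 r \<omega> = cond0 (loss0 u) \<omega> - cond0 (truncated_loss B u) \<omega>"
    unfolding r_def using integrable_loss[OF u, of 0] integrable_truncated_loss[OF u]
    by (rule F0.real_cond_exp_diff)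
  ultimately have "AE \<omega> in M. \<bar>innovation u \<omega> - centered B u \<omega>\<bar> \<le> t \<omega> + cond0 t \<omega>"
    using AE_space
  proof eventually_elim
    case (elim \<omega>)
    have "innovation u \<omega> - centered B u \<omega> = r \<omega> - cond0 r \<omega>"
      using elim(2) by (simp add: centered_loss_def r_def)
    then show ?case
      using elim(1) rt[OF elim(3)] by linarith
  qed
  then have "expectation (\<lambda>\<omega>. \<bar>innovation u \<omega> - centered B u \<omega>\<bar>) \<le> expectation (\<lambda>\<omega>. t \<omega> + cond0 t \<omega>)"
    using t ct(1) integrable_innovation[OF u] integrable_centered[OF u, of B]
    by (intro integral_mono_AE) auto
  also have "\<dots> = 2 * tail B"
    using t ct by (simp add: tail_def t_def[abs_def])
  finally show ?thesis .
qed

text \<open>The essential supremum at lag \<open>k\<close> in the mixing assumption. With it and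
  \<open>mixing_norm\<close> the assumption reads as a limit of upper limits, by unfolding
  alone.\<close>

definition correlation :: "real \<Rightarrow> nat \<Rightarrow> 'a \<Rightarrow> ereal" where
  "correlation B k = ess_Sup M
     {\<lambda>\<omega>. ereal \<bar>cond0 (\<lambda>\<omega>. centered B u (\<theta> (- int k) \<omega>) * centered B u' \<omega>) \<omega>\<bar> | u u'.
        u \<in> \<U>0 \<and> u' \<in> \<U>0}"

definition mixing_norm :: "real \<Rightarrow> nat \<Rightarrow> ennreal" where
  "mixing_norm B N = (\<integral>\<^sup>+\<omega>. e2ennreal \<bar>ereal (1 / real N) * (\<Sum>k=1..N. correlation B k \<omega>)\<bar> \<partial>M)"

lemma uniform_conditional_mixing_iff:
  "uniform_conditional_mixing M Y T U l \<Lambda> \<longleftrightarrow> ((\<lambda>B. limsup (mixing_norm B)) \<longlongrightarrow> 0) at_top"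
  unfolding uniform_conditional_mixing_def mixing_norm_def correlation_def ..

lemma is_ess_Sup_correlation:
  "is_ess_Sup M {\<lambda>\<omega>. ereal \<bar>cond0 (\<lambda>\<omega>. centered B u (\<theta> (- int k) \<omega>) * centered B u' \<omega>) \<omega>\<bar> | u u'.
     u \<in> \<U>0 \<and> u' \<in> \<U>0} (correlation B k)"
  unfolding correlation_def by (rule is_ess_Sup_ess_Sup) auto

lemma correlation_measurable [measurable]: "correlation B k \<in> borel_measurable M"
  using is_ess_Sup_correlation[of B k] by (simp add: is_ess_Sup_def)

lemma correlation_ge:
  assumes "u \<in> \<U>0" "u' \<in> \<U>0"
  shows "AE \<omega> in M. ereal \<bar>cond0 (\<lambda>\<omega>. centered B u (\<theta> (- int k) \<omega>) * centered B u' \<omega>) \<omega>\<bar>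
    \<le> correlation B k \<omega>"
  using is_ess_Sup_correlation[of B k, unfolded is_ess_Sup_def, THEN conjunct2, THEN conjunct1] assms
  by auto

lemma correlation_nonneg: "AE \<omega> in M. 0 \<le> correlation B k \<omega>"
proof -
  obtain u where u: "u \<in> \<U>0"
    using decisions_upto_nonempty by auto
  show ?thesis
    using correlation_ge[OF u u, of B k]
    by eventually_elim (auto intro: order.trans[rotated])
qed

text \<open>Each covariance is the integral of a conditional covariance, which is dominated by
  \<open>correlation B i\<close>. Because that bound is uniform over pairs of decisions,
  \<open>w i\<close> may change with the lag. As the correlations are nonnegative, the sum may be
  extended to all lags up to \<open>N\<close>; the factor \<open>of_nat N\<close> undoes the
  averaging in \<open>mixing_norm\<close>.\<close>

lemma sum_covariance_le:
  assumes w: "\<And>i. i \<in> {1..<n} \<Longrightarrow> w i \<in> \<U>0" and w': "w' \<in> \<U>0" and n: "n \<le> N" "0 < N"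
  shows "ennreal (\<Sum>i=1..<n. expectation (\<lambda>\<omega>. centered B (w i) (\<theta> (- int i) \<omega>) * centered B w' \<omega>))
    \<le> of_nat N * mixing_norm B N"
proof -
  define p where "p i \<omega> = centered B (w i) (\<theta> (- int i) \<omega>) * centered B w' \<omega>" for i \<omega>
  have p_int: "integrable M (p i)" if "i \<in> {1..<n}" for i
    unfolding p_def using w[OF that] w' by (intro integrable_centered_product decisions_upto_measurable)
  define g where "g \<omega> = (\<Sum>i=1..<n. \<bar>cond0 (p i) \<omega>\<bar>)" for \<omega>
  have g_int: "integrable M g"
    unfolding g_def using p_int
    by (intro Bochner_Integration.integrable_sum integrable_abs F0.real_cond_exp_int(1)) auto
  have "(\<Sum>i=1..<n. expectation (p i)) = (\<Sum>i=1..<n. expectation (cond0 (p i)))"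
    using p_int by (intro sum.cong refl F0.real_cond_exp_int(2)[symmetric])
  also have "\<dots> = expectation (\<lambda>\<omega>. \<Sum>i=1..<n. cond0 (p i) \<omega>)"
    using p_int by (intro Bochner_Integration.integral_sum[symmetric] F0.real_cond_exp_int(1))
  also have "\<dots> \<le> expectation g"
  proof (rule integral_mono)
    show "integrable M (\<lambda>\<omega>. \<Sum>i=1..<n. cond0 (p i) \<omega>)"
      using p_int by (intro Bochner_Integration.integrable_sum F0.real_cond_exp_int(1))
  qed (use g_int in \<open>auto simp: g_def intro: sum_mono\<close>)
  finally have "ennreal (\<Sum>i=1..<n. expectation (p i)) \<le> ennreal (expectation g)"
    by (rule ennreal_leI)
  also have "\<dots> = (\<integral>\<^sup>+\<omega>. ennreal (g \<omega>) \<partial>M)"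
    using g_int by (intro nn_integral_eq_integral[symmetric] AE_I2) (auto simp: g_def intro: sum_nonneg)
  also have "\<dots> \<le> (\<integral>\<^sup>+\<omega>. of_nat N * e2ennreal \<bar>ereal (1 / real N) * (\<Sum>k=1..N. correlation B k \<omega>)\<bar> \<partial>M)"
  proof (rule nn_integral_mono_AE)
    have "AE \<omega> in M. \<forall>i\<in>{1..<n}. ereal \<bar>cond0 (p i) \<omega>\<bar> \<le> correlation B i \<omega>"
      unfolding p_def using correlation_ge[OF w w'] by (subst AE_ball_countable) auto
    moreover have "AE \<omega> in M. \<forall>k\<in>{1..N}. 0 \<le> correlation B k \<omega>"
      using correlation_nonneg by (subst AE_ball_countable) auto
    ultimately show "AE \<omega> in M. ennreal (g \<omega>)
        \<le> of_nat N * e2ennreal \<bar>ereal (1 / real N) * (\<Sum>k=1..N. correlation B k \<omega>)\<bar>"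
    proof eventually_elim
      case (elim \<omega>)
      define s where "s = (\<Sum>k=1..N. correlation B k \<omega>)"
      have "ereal (g \<omega>) = (\<Sum>i=1..<n. ereal \<bar>cond0 (p i) \<omega>\<bar>)"
        by (simp add: g_def)
      also have "\<dots> \<le> (\<Sum>i=1..<n. correlation B i \<omega>)"
        using elim(1) by (intro sum_mono) auto
      also have "\<dots> \<le> s"
        unfolding s_def using elim(2) n by (intro sum_mono2) auto
      finally have "ereal (g \<omega>) \<le> s" .
      moreover have "0 \<le> g \<omega>"
        by (auto simp: g_def intro: sum_nonneg)
      \<comment> \<open>The sum \<open>s\<close> may be infinite; the right side is then infinite as
        well, since \<open>N\<close> is positive.\<close>
      ultimately show ?case
        unfolding s_def[symmetric] using n(2)
        by (cases s)
           (auto simp: ennreal_mult[symmetric] ennreal_of_nat_eq_real_of_nat ennreal_mult_top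
             intro!: ennreal_leI)
    qed
  qed
  also have "\<dots> = of_nat N * mixing_norm B N"
    unfolding mixing_norm_def by (rule nn_integral_cmult) measurable
  finally show ?thesis
    by (simp add: p_def[abs_def])
qed

text \<open>After division by the square of \<open>N\<close>, the \<open>N\<close> diagonal terms,
  each at most \<open>4 * B\<^sup>2\<close>, contribute \<open>4 * B\<^sup>2 / real N\<close>. For
  each of the \<open>N\<close> later indices, the covariances over all lags sum to at most
  \<open>real N * e\<close> and are counted twice, which contributes \<open>2 * e\<close>.\<close>

lemma second_moment_le:
  assumes w: "\<And>k. k \<ge> 1 \<Longrightarrow> w k \<in> \<U>0" and N: "0 < N" and e: "0 \<le> e" "mixing_norm B N \<le> ennreal e"
  shows "expectation (\<lambda>\<omega>. (1 / real N * (\<Sum>k=1..N. centered B (w k) (\<theta> (int k) \<omega>)))\<^sup>2)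
    \<le> 4 * B\<^sup>2 / real N + 2 * e"
proof -
  define q where "q j k i \<omega> = centered B (w j) (\<theta> i \<omega>) * centered B (w k) \<omega>" for j k i \<omega>
  have w_meas: "w k \<in> M \<rightarrow>\<^sub>M U" if "k \<ge> 1" for k
    using w[OF that] by (rule decisions_upto_measurable)
  have q_int: "integrable M (q j k i)" if "j \<ge> 1" "k \<ge> 1" for j k i
    unfolding q_def using that by (intro integrable_centered_product w_meas)
  have q_int': "integrable M (\<lambda>\<omega>. q j k i (\<theta> n \<omega>))"
    and q_exp: "expectation (\<lambda>\<omega>. q j k i (\<theta> n \<omega>)) = expectation (q j k i)"
    if "j \<ge> 1" "k \<ge> 1" for j k i n
    using q_int[OF that] by (auto intro: integrable_tpow integral_tpow)
  \<comment> \<open>Read from time \<open>k\<close>, the earlier factor is shifted by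
    \<open>- i\<close>. The product is thus a shift by \<open>k\<close> of an expression of the kind
    in the mixing assumption, and invariance removes that outer shift.\<close>
  have lag: "centered B (w (k - i)) (\<theta> (int (k - i)) \<omega>) * centered B (w k) (\<theta> (int k) \<omega>)
      = q (k - i) k (- int i) (\<theta> (int k) \<omega>)" if "\<omega> \<in> space M" "i < k" for \<omega> k i
    unfolding q_def using that by (simp add: tpow_tpow)
  have cov: "(\<Sum>i=1..<k. expectation (q (k - i) k (- int i))) \<le> real N * e" if k: "k \<in> {1..N}" for k
  proof -
    have "ennreal (\<Sum>i=1..<k. expectation (q (k - i) k (- int i))) \<le> of_nat N * mixing_norm B N"
      unfolding q_def using k N w by (intro sum_covariance_le[of k "\<lambda>i. w (k - i)" "w k"]) auto
    also have "\<dots> \<le> of_nat N * ennreal e"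
      using e(2) by (intro mult_left_mono) auto
    also have "\<dots> = ennreal (real N * e)"
      using e(1) by (simp add: ennreal_mult ennreal_of_nat_eq_real_of_nat)
    finally show ?thesis
      using e(1) by (simp add: ennreal_le_iff)
  qed
  have diag: "expectation (q k k 0) \<le> 4 * B\<^sup>2" if "k \<in> {1..N}" for k
  proof -
    have "expectation (q k k 0) \<le> expectation (\<lambda>\<omega>. 4 * B\<^sup>2)"
      using centered_product_bound[OF w_meas w_meas, of k k B 0] q_int[of k k 0] that
      by (intro integral_mono_AE) (auto simp: q_def elim!: eventually_mono)
    then show ?thesis
      by (simp add: prob_space)
  qed
  have "expectation (\<lambda>\<omega>. (1 / real N * (\<Sum>k=1..N. centered B (w k) (\<theta> (int k) \<omega>)))\<^sup>2)
      = expectation (\<lambda>\<omega>. (1 / real N)\<^sup>2 * (\<Sum>k=1..N. q k k 0 (\<theta> (int k) \<omega>)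
          + 2 * (\<Sum>i=1..<k. q (k - i) k (- int i) (\<theta> (int k) \<omega>))))"
  proof (rule Bochner_Integration.integral_cong[OF refl])
    fix \<omega> assume \<omega>: "\<omega> \<in> space M"
    show "(1 / real N * (\<Sum>k=1..N. centered B (w k) (\<theta> (int k) \<omega>)))\<^sup>2
      = (1 / real N)\<^sup>2 * (\<Sum>k=1..N. q k k 0 (\<theta> (int k) \<omega>)
          + 2 * (\<Sum>i=1..<k. q (k - i) k (- int i) (\<theta> (int k) \<omega>)))"
      unfolding power_mult_distrib square_sum_by_lags using \<omega> lag
      by (intro arg_cong2[where f = "(*)"] arg_cong2[where f = "(+)"] sum.cong refl)
         (auto simp: q_def)
  qed
  also have "\<dots> = (1 / real N)\<^sup>2 * (\<Sum>k=1..N. expectation (q k k 0)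
      + 2 * (\<Sum>i=1..<k. expectation (q (k - i) k (- int i))))"
  proof -
    let ?s = "\<lambda>k \<omega>. \<Sum>i=1..<k. q (k - i) k (- int i) (\<theta> (int k) \<omega>)"
    have s: "integrable M (?s k)" for k
      by (intro Bochner_Integration.integrable_sum q_int') auto
    have s_exp: "expectation (?s k) = (\<Sum>i=1..<k. expectation (q (k - i) k (- int i)))" for k
      by (subst Bochner_Integration.integral_sum) (auto intro!: q_int' q_exp sum.cong)
    have "expectation (\<lambda>\<omega>. q k k 0 (\<theta> (int k) \<omega>) + 2 * ?s k \<omega>)
        = expectation (q k k 0) + 2 * (\<Sum>i=1..<k. expectation (q (k - i) k (- int i)))" if "k \<in> {1..N}" for k
      using that q_int'[of k k] q_exp[of k k] s[of k] s_exp[of k] by simp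
    moreover have "integrable M (\<lambda>\<omega>. q k k 0 (\<theta> (int k) \<omega>) + 2 * ?s k \<omega>)" if "k \<in> {1..N}" for k
      using that q_int'[of k k] s[of k] by simp
    ultimately show ?thesis
      by (subst integral_mult_right_zero, subst Bochner_Integration.integral_sum) auto
  qed
  also have "\<dots> \<le> (1 / real N)\<^sup>2 * (\<Sum>k=1..N. 4 * B\<^sup>2 + 2 * (real N * e))"
    using cov diag by (intro mult_left_mono sum_mono add_mono) auto
  also have "\<dots> = 4 * B\<^sup>2 / real N + 2 * e"
    using N by (simp add: field_simps power2_eq_square)
  finally show ?thesis .
qed

section \<open>Pathwise optimality\<close>

text \<open>The level \<open>B\<close> is fixed first, making both the tail of
  \<open>\<Lambda>\<close> and the upper limit of the mixing norms small; only then is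
  \<open>N\<close> taken large. The centered part \<open>p\<close> is estimated by its second moment
  and the truncation part \<open>q\<close> in the mean, each by \<open>e / 2\<close>.\<close>

lemma innovation_averages_tendsto_zero:
  assumes mixing: "uniform_conditional_mixing M Y T U l \<Lambda>" and w: "\<And>k. k \<ge> 1 \<Longrightarrow> w k \<in> \<U>0"
  shows "(\<lambda>N. expectation (\<lambda>\<omega>. \<bar>1 / real N * (\<Sum>k=1..N. innovation (w k) (\<theta> (int k) \<omega>))\<bar>)) \<longlonglongrightarrow> 0"
proof (rule tendsto_zero_le)
  fix e :: real assume e: "0 < e"
  have w_meas: "w k \<in> M \<rightarrow>\<^sub>M U" if "k \<ge> 1" for k
    using w[OF that] by (rule decisions_upto_measurable)
  \<comment> \<open>With \<open>4 * B\<^sup>2 / real N\<close> below \<open>2 * d\<close>, the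
    second moment of \<open>p\<close> is at most \<open>4 * d\<close>, which is the square of
    \<open>e / 2\<close>.\<close>
  define d where "d = e\<^sup>2 / 16"
  have d: "0 < d"
    using e by (simp add: d_def)
  have "\<forall>\<^sub>F B in at_top. limsup (mixing_norm B) < ennreal d"
    using mixing d unfolding uniform_conditional_mixing_iff by (intro order_tendstoD(2)) auto
  moreover have "\<forall>\<^sub>F B in at_top. tail B < e / 4"
    using tail_tendsto_zero e by (intro order_tendstoD(2)) auto
  ultimately have "\<forall>\<^sub>F B in at_top. limsup (mixing_norm B) < ennreal d \<and> tail B < e / 4"
    by (rule eventually_conj)
  then obtain B where B: "limsup (mixing_norm B) < ennreal d" "tail B < e / 4"
    using eventually_happens'[OF trivial_limit_at_top_linorder] by blast
  have "(\<lambda>N. 4 * B\<^sup>2 / real N) \<longlonglongrightarrow> 0"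
    by (rule lim_const_over_n)
  then have "\<forall>\<^sub>F N in sequentially. 4 * B\<^sup>2 / real N < 2 * d"
    using d by (intro order_tendstoD(2)) auto
  moreover have "\<forall>\<^sub>F N in sequentially. mixing_norm B N < ennreal d"
    using B(1) by (rule Limsup_lessD)
  ultimately show "\<forall>\<^sub>F N in sequentially.
      expectation (\<lambda>\<omega>. \<bar>1 / real N * (\<Sum>k=1..N. innovation (w k) (\<theta> (int k) \<omega>))\<bar>) \<le> e"
    using eventually_gt_at_top[of 0]
  proof eventually_elim
    case (elim N)
    let ?A = "\<lambda>f \<omega>. 1 / real N * (\<Sum>k=1..N. f k (\<theta> (int k) \<omega>))"
    define p where "p = ?A (\<lambda>k. centered B (w k))"
    define q where "q = ?A (\<lambda>k \<omega>. innovation (w k) \<omega> - centered B (w k) \<omega>)"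
    have diff_int: "integrable M (\<lambda>\<omega>. innovation (w k) \<omega> - centered B (w k) \<omega>)" if "k \<ge> 1" for k
      using integrable_innovation[OF w_meas[OF that]] integrable_centered[OF w_meas[OF that]]
      by (rule Bochner_Integration.integrable_diff)
    have p_int: "integrable M p"
      unfolding p_def by (intro integrable_average integrable_centered w_meas)
    have q_int: "integrable M q"
      unfolding q_def by (intro integrable_average diff_int)
    have split: "?A (\<lambda>k. innovation (w k)) \<omega> = p \<omega> + q \<omega>" for \<omega>
      unfolding p_def q_def distrib_left[symmetric] sum.distrib[symmetric] by simp
    have "expectation (\<lambda>\<omega>. \<bar>q \<omega>\<bar>) \<le> 2 * tail B"
      unfolding q_def using diff_int truncation_error w_meas tail_nonneg by (intro L1_average_le) auto
    moreover have "expectation (\<lambda>\<omega>. \<bar>p \<omega>\<bar>) \<le> e / 2"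
    proof -
      have "AE \<omega> in M. \<forall>k\<in>{1..N}. \<bar>centered B (w k) (\<theta> (int k) \<omega>)\<bar> \<le> 2 * \<bar>B\<bar>"
        using AE_tpow[OF centered_bound[OF w_meas]] by (subst AE_ball_countable) auto
      then have "AE \<omega> in M. \<bar>p \<omega>\<bar> \<le> 2 * \<bar>B\<bar>"
      proof eventually_elim
        case (elim \<omega>)
        have "\<bar>p \<omega>\<bar> \<le> 1 / real N * (\<Sum>k=1..N. \<bar>centered B (w k) (\<theta> (int k) \<omega>)\<bar>)"
          unfolding p_def abs_mult by (intro mult_mono sum_abs) auto
        also have "\<dots> \<le> 1 / real N * (\<Sum>k=1..N. 2 * \<bar>B\<bar>)"
          using elim by (intro mult_left_mono sum_mono) auto
        also have "\<dots> = 2 * \<bar>B\<bar>"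
          using \<open>0 < N\<close> by simp
        finally show ?case .
      qed
      then have "AE \<omega> in M. norm ((p \<omega>)\<^sup>2) \<le> (2 * \<bar>B\<bar>)\<^sup>2"
        by eventually_elim (metis abs_ge_zero abs_power2 power2_abs power_mono real_norm_def)
      then have p2_int: "integrable M (\<lambda>\<omega>. (p \<omega>)\<^sup>2)"
        using p_int by (intro integrable_const_bound) auto
      have "expectation (\<lambda>\<omega>. \<bar>p \<omega>\<bar>) \<le> sqrt (expectation (\<lambda>\<omega>. (p \<omega>)\<^sup>2))"
        using p_int p2_int by (intro expectation_abs_le_sqrt) auto
      also have "expectation (\<lambda>\<omega>. (p \<omega>)\<^sup>2) \<le> 4 * B\<^sup>2 / real N + 2 * d"
        unfolding p_def using w elim d by (intro second_moment_le) auto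
      also have "\<dots> \<le> (e / 2)\<^sup>2"
        using elim(1) by (simp add: d_def power2_eq_square)
      finally show ?thesis
        using e by simp
    qed
    moreover have "expectation (\<lambda>\<omega>. \<bar>?A (\<lambda>k. innovation (w k)) \<omega>\<bar>) \<le> expectation (\<lambda>\<omega>. \<bar>p \<omega>\<bar> + \<bar>q \<omega>\<bar>)"
      unfolding split using p_int q_int by (intro integral_mono) auto
    ultimately show ?case
      using B(2) p_int q_int by simp
  qed
qed (auto intro: integral_nonneg_AE)

section \<open>A lower bound in the mean for every admissible strategy\<close>

lemma avg_loss_eq:
  assumes "\<omega> \<in> space M"
  shows "avg_loss M T l N u \<omega>
    = 1 / real N * (\<Sum>k=1..N. loss0 (\<lambda>\<omega>. u k (\<theta> (- int k) \<omega>)) (\<theta> (int k) \<omega>))"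
  unfolding avg_loss_def using loss_tpow[OF assms] by simp

lemma admissible_measurable: "admissible M Y T U u \<Longrightarrow> k \<ge> 1 \<Longrightarrow> u k \<in> M \<rightarrow>\<^sub>M U"
  by (auto simp: admissible_def intro: decisions_measurable)

text \<open>A decision using the observations from time 0 to \<open>k\<close> uses those from
  \<open>- k\<close> to 0 after the shift. The memory grows with \<open>k\<close> but is finite for
  each \<open>k\<close>, as membership in \<open>\<U>0\<close> demands.\<close>

lemma admissible_shift:
  assumes "admissible M Y T U u" "k \<ge> 1"
  shows "(\<lambda>\<omega>. u k (\<theta> (- int k) \<omega>)) \<in> \<U>0"
  using decisions_tpow[of "u k" 0 "int k" "- int k"] assms by (auto simp: admissible_def decisions_upto_def)

lemma integrable_avg_loss:
  assumes "admissible M Y T U u"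
  shows "integrable M (avg_loss M T l N u)"
  unfolding avg_loss_def[abs_def] using admissible_measurable[OF assms]
  by (intro integrable_mult_right Bochner_Integration.integrable_sum integrable_loss) auto

text \<open>The average loss is \<open>p N\<close> plus the average of shifted conditional losses,
  which lie above \<open>real_value\<close>. A shortfall below the optimal loss is therefore at most
  \<open>\<bar>p N \<omega>\<bar> + \<bar>q N \<omega>\<bar>\<close>: the first term vanishes in the
  mean by mixing, the second by the ergodic theorem.\<close>

lemma lower_deviation_tendsto_zero:
  assumes mixing: "uniform_conditional_mixing M Y T U l \<Lambda>" and u: "admissible M Y T U u"
  shows "(\<lambda>N. expectation (\<lambda>\<omega>. max (optimal_loss M Y T U l - avg_loss M T l N u \<omega>) 0)) \<longlonglongrightarrow> 0"
proof (rule tendsto_sandwich[OF always_eventually always_eventually tendsto_const])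
  let ?L = "optimal_loss M Y T U l"
  define w where "w k \<omega> = u k (\<theta> (- int k) \<omega>)" for k \<omega>
  have w: "w k \<in> \<U>0" if "k \<ge> 1" for k
    unfolding w_def using u that by (rule admissible_shift)
  have w_meas: "w k \<in> M \<rightarrow>\<^sub>M U" if "k \<ge> 1" for k
    using w[OF that] by (rule decisions_upto_measurable)
  define p where "p N \<omega> = 1 / real N * (\<Sum>k=1..N. innovation (w k) (\<theta> (int k) \<omega>))" for N \<omega>
  define q where "q N \<omega> = 1 / real N * (\<Sum>k=1..N. real_value (\<theta> (int k) \<omega>)) - ?L" for N \<omega>
  have p_int: "integrable M (p N)" for N
    unfolding p_def[abs_def] using w_meas by (intro integrable_average integrable_innovation)
  have q_int: "integrable M (q N)" for N
    unfolding q_def[abs_def]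
    using integrable_real_value by (intro Bochner_Integration.integrable_diff integrable_average) auto
  show "\<forall>N. 0 \<le> expectation (\<lambda>\<omega>. max (?L - avg_loss M T l N u \<omega>) 0)"
    by (auto intro: integral_nonneg_AE)
  show "\<forall>N. expectation (\<lambda>\<omega>. max (?L - avg_loss M T l N u \<omega>) 0)
      \<le> expectation (\<lambda>\<omega>. \<bar>p N \<omega>\<bar>) + expectation (\<lambda>\<omega>. \<bar>q N \<omega>\<bar>)"
  proof
    fix N
    have "AE \<omega> in M. \<forall>k\<in>{1..N}. real_value (\<theta> (int k) \<omega>) \<le> cond0 (loss0 (w k)) (\<theta> (int k) \<omega>)"
      using AE_tpow[OF real_value_le[OF w]] by (subst AE_ball_countable) auto
    then have "AE \<omega> in M. max (?L - avg_loss M T l N u \<omega>) 0 \<le> \<bar>p N \<omega>\<bar> + \<bar>q N \<omega>\<bar>"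
      using AE_space
    proof eventually_elim
      case (elim \<omega>)
      have "p N \<omega> + (1 / real N * (\<Sum>k=1..N. real_value (\<theta> (int k) \<omega>)))
          \<le> p N \<omega> + (1 / real N * (\<Sum>k=1..N. cond0 (loss0 (w k)) (\<theta> (int k) \<omega>)))"
        using elim(1) by (intro add_left_mono mult_left_mono sum_mono) auto
      also have "\<dots> = avg_loss M T l N u \<omega>"
        unfolding avg_loss_eq[OF elim(2)] p_def
        by (simp add: sum_subtractf diff_divide_distrib w_def[abs_def])
      finally show ?case
        unfolding q_def by linarith
    qed
    then have "expectation (\<lambda>\<omega>. max (?L - avg_loss M T l N u \<omega>) 0) \<le> expectation (\<lambda>\<omega>. \<bar>p N \<omega>\<bar> + \<bar>q N \<omega>\<bar>)"
      using integrable_avg_loss[OF u, of N] p_int[of N] q_int[of N] by (intro integral_mono_AE) auto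
    also have "\<dots> = expectation (\<lambda>\<omega>. \<bar>p N \<omega>\<bar>) + expectation (\<lambda>\<omega>. \<bar>q N \<omega>\<bar>)"
      using p_int[of N] q_int[of N] by simp
    finally show "expectation (\<lambda>\<omega>. max (?L - avg_loss M T l N u \<omega>) 0)
      \<le> expectation (\<lambda>\<omega>. \<bar>p N \<omega>\<bar>) + expectation (\<lambda>\<omega>. \<bar>q N \<omega>\<bar>)" .
  qed
  have "(\<lambda>N. expectation (\<lambda>\<omega>. \<bar>p N \<omega>\<bar>)) \<longlonglongrightarrow> 0"
    unfolding p_def using mixing w by (rule innovation_averages_tendsto_zero)
  moreover have "(\<lambda>N. expectation (\<lambda>\<omega>. \<bar>q N \<omega>\<bar>)) \<longlonglongrightarrow> 0"
    unfolding q_def optimal_loss_eq using integrable_real_value by (rule mean_ergodic)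
  ultimately show "(\<lambda>N. expectation (\<lambda>\<omega>. \<bar>p N \<omega>\<bar>) + expectation (\<lambda>\<omega>. \<bar>q N \<omega>\<bar>)) \<longlonglongrightarrow> 0"
    by (rule tendsto_add_zero)
qed

text \<open>The essential infimum lies below the conditional loss of the single competitor
  \<open>u\<close>; integrating the resulting almost sure inequality removes the
  conditioning.\<close>

lemma mean_optimal_expectation_le:
  assumes v: "mean_optimal M Y T U l v" and k: "k \<ge> 1" and u: "u \<in> decisions M Y T U 0 (int k)"
  shows "expectation (loss M T l (int k) (v k)) \<le> expectation (loss M T l (int k) u) + 1 / real k"
proof -
  interpret F: finite_measure_subalgebra M "\<F> {0..int k}"
    by (rule finite_subalgebra_obs)
  let ?E = "\<lambda>u. real_cond_exp M (\<F> {0..int k}) (loss M T l (int k) u)"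
  let ?C = "{\<lambda>\<omega>. ereal (?E u \<omega>) | u. u \<in> decisions M Y T U 0 (int k)}"
  have v_meas: "v k \<in> M \<rightarrow>\<^sub>M U"
    using v k by (auto simp: mean_optimal_def intro: admissible_measurable)
  have inf: "is_ess_Inf M ?C (ess_Inf M ?C)"
    by (rule is_ess_Inf_ess_Inf) auto
  have "AE \<omega> in M. ess_Inf M ?C \<omega> \<le> ereal (?E u \<omega>)"
    using inf[unfolded is_ess_Inf_def, THEN conjunct2, THEN conjunct1] u by auto
  moreover have "AE \<omega> in M. ereal (?E (v k) \<omega>) \<le> ess_Inf M ?C \<omega> + ereal (1 / real k)"
    using v k by (auto simp: mean_optimal_def)
  ultimately have le: "AE \<omega> in M. ?E (v k) \<omega> \<le> ?E u \<omega> + 1 / real k"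
  proof eventually_elim
    case (elim \<omega>)
    have "ereal (?E (v k) \<omega>) \<le> ereal (?E u \<omega>) + ereal (1 / real k)"
      using elim by (meson add_right_mono order.trans)
    then show ?case
      by simp
  qed
  note int = integrable_loss[OF v_meas, of "int k"] integrable_loss[OF decisions_measurable[OF u], of "int k"]
  have "expectation (loss M T l (int k) (v k)) = expectation (?E (v k))"
    using int(1) by (rule F.real_cond_exp_int(2)[symmetric])
  also have "\<dots> \<le> expectation (\<lambda>\<omega>. ?E u \<omega> + 1 / real k)"
    using le F.real_cond_exp_int(1)[OF int(1)] F.real_cond_exp_int(1)[OF int(2)]
    by (intro integral_mono_AE) auto
  also have "\<dots> = expectation (loss M T l (int k) u) + 1 / real k"
    using F.real_cond_exp_int[OF int(2)] by (simp add: prob_space)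
  finally show ?thesis .
qed

text \<open>A near-optimal decision with finite memory, moved to time \<open>k\<close>, keeps its
  expected loss by invariance and uses observations from \<open>m + int k\<close> onwards. For large
  \<open>k\<close> it competes with \<open>v k\<close>, which is then at most
  \<open>1 / real k\<close> worse in expectation.\<close>

lemma mean_optimal_excess_tendsto_zero:
  assumes v: "mean_optimal M Y T U l v"
  shows "(\<lambda>k. max (expectation (loss M T l (int k) (v k)) - optimal_loss M Y T U l) 0) \<longlonglongrightarrow> 0"
proof (rule tendsto_zero_le)
  fix e :: real assume e: "0 < e"
  then obtain u where u: "u \<in> \<U>0" "expectation (loss0 u) \<le> optimal_loss M Y T U l + e / 2"
    using ex_near_optimal_decision[of "e / 2"] by auto
  then obtain m where m: "m \<le> 0" "u \<in> decisions M Y T U m 0"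
    by (auto simp: decisions_upto_def)
  have "\<forall>\<^sub>F k in sequentially. 1 / real k < e / 2"
    using lim_1_over_n e by (intro order_tendstoD(2)) auto
  \<comment> \<open>The threshold \<open>Suc (nat (- m))\<close> ensures both that \<open>k\<close>
    is at least 1 and that \<open>m + int k\<close> is nonnegative.\<close>
  then show "\<forall>\<^sub>F k in sequentially.
      max (expectation (loss M T l (int k) (v k)) - optimal_loss M Y T U l) 0 \<le> e"
    using eventually_ge_at_top[of "Suc (nat (- m))"]
  proof eventually_elim
    case (elim k)
    define u' where "u' \<omega> = u (\<theta> (int k) \<omega>)" for \<omega>
    have "u' \<in> decisions M Y T U (m + int k) (0 + int k)"
      unfolding u'_def using m(2) by (rule decisions_tpow)
    moreover have low: "0 \<le> m + int k"
      using elim(2) by linarith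
    ultimately have u': "u' \<in> decisions M Y T U 0 (int k)"
      using decisions_mono[of 0 "m + int k" "int k"] low by auto
    have "expectation (loss M T l (int k) u') = expectation (\<lambda>\<omega>. loss0 u (\<theta> (int k) \<omega>))"
      by (simp add: loss_def[abs_def] u'_def)
    also have "\<dots> = expectation (loss0 u)"
      using decisions_upto_measurable[OF u(1)] by (intro integral_tpow loss_measurable)
    finally show ?case
      using mean_optimal_expectation_le[OF v _ u'] u(2) elim e by auto
  qed
qed auto

text \<open>An absolute value is the number itself plus twice its negative part. The distance in the
  mean is thus the expected average loss minus the optimal loss, plus twice the lower deviation. The
  former is at most the Cesaro mean of the excesses \<open>a k\<close>, so an upper bound on
  expectations alone complements the lower deviation bound.\<close>

lemma avg_loss_L1_tendsto:
  assumes mixing: "uniform_conditional_mixing M Y T U l \<Lambda>" and v: "mean_optimal M Y T U l v"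
  shows "(\<lambda>N. expectation (\<lambda>\<omega>. \<bar>avg_loss M T l N v \<omega> - optimal_loss M Y T U l\<bar>)) \<longlonglongrightarrow> 0"
proof (rule tendsto_sandwich[OF always_eventually _ tendsto_const])
  let ?L = "optimal_loss M Y T U l"
  have adm: "admissible M Y T U v"
    using v by (simp add: mean_optimal_def)
  define a where "a k = max (expectation (loss M T l (int k) (v k)) - ?L) 0" for k
  define b where "b N = expectation (\<lambda>\<omega>. max (?L - avg_loss M T l N v \<omega>) 0)" for N
  show "\<forall>N. 0 \<le> expectation (\<lambda>\<omega>. \<bar>avg_loss M T l N v \<omega> - ?L\<bar>)"
    by (auto intro: integral_nonneg_AE)
  show "\<forall>\<^sub>F N in sequentially. expectation (\<lambda>\<omega>. \<bar>avg_loss M T l N v \<omega> - ?L\<bar>)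
      \<le> 1 / real N * (\<Sum>k=1..N. a k) + 2 * b N"
    \<comment> \<open>Positive \<open>N\<close> is required for the constant optimal loss to equal
      its own average.\<close>
    using eventually_gt_at_top[of 0]
  proof eventually_elim
    case (elim N)
    note int = integrable_avg_loss[OF adm, of N]
    have "expectation (\<lambda>\<omega>. \<bar>avg_loss M T l N v \<omega> - ?L\<bar>)
        = expectation (\<lambda>\<omega>. (avg_loss M T l N v \<omega> - ?L) + 2 * max (?L - avg_loss M T l N v \<omega>) 0)"
      by (intro Bochner_Integration.integral_cong) (auto simp: max_def)
    also have "\<dots> = expectation (avg_loss M T l N v) - ?L + 2 * b N"
      using int by (simp add: b_def prob_space)
    also have "expectation (avg_loss M T l N v)
        = 1 / real N * (\<Sum>k=1..N. expectation (loss M T l (int k) (v k)))"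
      unfolding avg_loss_def[abs_def]
      using integrable_loss[OF admissible_measurable[OF adm]]
      by (subst integral_mult_right_zero, subst Bochner_Integration.integral_sum) auto
    also have "\<dots> \<le> 1 / real N * (\<Sum>k=1..N. a k + ?L)"
      by (intro mult_left_mono sum_mono) (auto simp: a_def)
    also have "\<dots> = 1 / real N * (\<Sum>k=1..N. a k) + ?L"
      using elim by (simp add: sum.distrib field_simps)
    finally show ?case
      by simp
  qed
  have "(\<lambda>N. 1 / real N * (\<Sum>k=1..N. a k)) \<longlonglongrightarrow> 0"
    unfolding a_def using v by (intro cesaro_null mean_optimal_excess_tendsto_zero)
  moreover have "b \<longlonglongrightarrow> 0"
    unfolding b_def[abs_def] using mixing adm by (rule lower_deviation_tendsto_zero)
  ultimately show "(\<lambda>N. 1 / real N * (\<Sum>k=1..N. a k) + 2 * b N) \<longlonglongrightarrow> 0"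
    by (auto intro!: tendsto_add_zero tendsto_mult_right_zero)
qed

text \<open>If \<open>u\<close> beats \<open>v\<close> by more than \<open>e\<close> at horizon
  \<open>N\<close>, then its shortfall below the optimal loss and the deviation of \<open>v\<close>
  from it add up to more than \<open>e\<close>. This sum, \<open>X N\<close>, tends to 0 in the
  mean, and Markov's inequality concludes.\<close>

lemma mean_optimal_weakly_pathwise_optimal:
  assumes mixing: "uniform_conditional_mixing M Y T U l \<Lambda>" and v: "mean_optimal M Y T U l v"
  shows "weakly_pathwise_optimal M Y T U l v"
  unfolding weakly_pathwise_optimal_def
proof (intro allI impI)
  fix u and e :: real
  assume u: "admissible M Y T U u" and e: "0 < e"
  let ?L = "optimal_loss M Y T U l"
  have adm: "admissible M Y T U v"
    using v by (simp add: mean_optimal_def)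
  define X where "X N \<omega> = max (?L - avg_loss M T l N u \<omega>) 0 + \<bar>avg_loss M T l N v \<omega> - ?L\<bar>" for N \<omega>
  note int = integrable_avg_loss[OF u] integrable_avg_loss[OF adm]
  note [measurable] = borel_measurable_integrable[OF int(1)] borel_measurable_integrable[OF int(2)]
  have X_int: "integrable M (X N)" for N
    unfolding X_def[abs_def] using int[of N] by auto
  note [measurable] = borel_measurable_integrable[OF X_int]
  have "(\<lambda>N. expectation (X N)) \<longlonglongrightarrow> 0"
  proof -
    have "expectation (X N) = expectation (\<lambda>\<omega>. max (?L - avg_loss M T l N u \<omega>) 0)
        + expectation (\<lambda>\<omega>. \<bar>avg_loss M T l N v \<omega> - ?L\<bar>)" for N
      unfolding X_def[abs_def] using int[of N] by simp
    then show ?thesis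
      using tendsto_add_zero[OF lower_deviation_tendsto_zero[OF mixing u] avg_loss_L1_tendsto[OF mixing v]]
      by simp
  qed
  then have lim: "(\<lambda>N. 1 - expectation (X N) / e) \<longlonglongrightarrow> 1 - 0 / e"
    by (intro tendsto_intros) (use e in auto)
  show "(\<lambda>N. prob {\<omega> \<in> space M. - e \<le> avg_loss M T l N u \<omega> - avg_loss M T l N v \<omega>}) \<longlonglongrightarrow> 1"
  proof (rule tendsto_sandwich[OF always_eventually always_eventually _ tendsto_const])
    show "\<forall>N. 1 - expectation (X N) / e
        \<le> prob {\<omega> \<in> space M. - e \<le> avg_loss M T l N u \<omega> - avg_loss M T l N v \<omega>}"
    proof
      fix N
      have "prob {\<omega> \<in> space M. e \<le> X N \<omega>} \<le> expectation (X N) / e"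
        by (rule integral_Markov_inequality_measure[OF X_int sets.empty_sets]) (use e in \<open>auto simp: X_def\<close>)
      moreover have "prob (space M - {\<omega> \<in> space M. e \<le> X N \<omega>}) = 1 - prob {\<omega> \<in> space M. e \<le> X N \<omega>}"
        by (rule prob_compl) measurable
      moreover have "prob (space M - {\<omega> \<in> space M. e \<le> X N \<omega>})
          \<le> prob {\<omega> \<in> space M. - e \<le> avg_loss M T l N u \<omega> - avg_loss M T l N v \<omega>}"
        by (rule finite_measure_mono) (auto simp: X_def max_def abs_if not_le split: if_splits)
      ultimately show "1 - expectation (X N) / e
          \<le> prob {\<omega> \<in> space M. - e \<le> avg_loss M T l N u \<omega> - avg_loss M T l N v \<omega>}"
        by linarith
    qed
    show "(\<lambda>N. 1 - expectation (X N) / e) \<longlonglongrightarrow> 1"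
      using lim by simp
  qed auto
qed

end

theorem theorem2p13:
  fixes M Y :: "'a measure"
    and T :: "'a \<Rightarrow> 'a"
    and U :: "'u measure"
    and l :: "'u \<Rightarrow> 'a \<Rightarrow> real"
    and \<Lambda> :: "'a \<Rightarrow> real"
    and v :: "nat \<Rightarrow> 'a \<Rightarrow> 'u"
  assumes "prob_space M"
    and "subalgebra M Y"
    and "ergodic_automorphism M T"
    and "(\<lambda>(x, \<omega>). l x \<omega>) \<in> borel_measurable (U \<Otimes>\<^sub>M M)"
    and "integrable M \<Lambda>"
    and "\<And>x \<omega>. x \<in> space U \<Longrightarrow> \<omega> \<in> space M \<Longrightarrow> \<bar>l x \<omega>\<bar> \<le> \<Lambda> \<omega>"
    and "mean_optimal M Y T U l v"
    and "uniform_conditional_mixing M Y T U l \<Lambda>"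
  shows "weakly_pathwise_optimal M Y T U l v \<and>
         (\<lambda>N. \<integral>\<^sup>+\<omega>. ennreal \<bar>avg_loss M T l N v \<omega> - optimal_loss M Y T U l\<bar> \<partial>M) \<longlonglongrightarrow> 0"
proof -
  interpret ergodic_system M T
    using assms(1,3) by (simp add: ergodic_system_def ergodic_system_axioms_def)
  \<comment> \<open>The strategy supplies a map into \<open>U\<close> from a nonempty space, which
    gives the nonemptiness of \<open>space U\<close> required by
    \<open>decision_problem\<close>.\<close>
  have "v 1 \<in> obs M Y T {0..1} \<rightarrow>\<^sub>M U"
    using assms(7) by (auto simp: mean_optimal_def admissible_def decisions_def dest: spec[of _ 1])
  moreover have "space (obs M Y T {0..1}) \<noteq> {}"
    using not_empty by (simp add: obs_def space_measure_of_conv)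
  ultimately have "space U \<noteq> {}"
    by (auto dest: measurable_space)
  then interpret decision_problem M T Y U l \<Lambda>
    using assms(2,4,5,6) by unfold_locales
  have int: "integrable M (\<lambda>\<omega>. \<bar>avg_loss M T l N v \<omega> - optimal_loss M Y T U l\<bar>)" for N
    using integrable_avg_loss assms(7) by (auto simp: mean_optimal_def)
  have "(\<lambda>N. \<integral>\<^sup>+\<omega>. ennreal \<bar>avg_loss M T l N v \<omega> - optimal_loss M Y T U l\<bar> \<partial>M)
      = (\<lambda>N. ennreal (expectation (\<lambda>\<omega>. \<bar>avg_loss M T l N v \<omega> - optimal_loss M Y T U l\<bar>)))"
    using int by (intro ext nn_integral_eq_integral) auto
  also have "\<dots> \<longlonglongrightarrow> ennreal 0"
    using avg_loss_L1_tendsto[OF assms(8,7)] by (rule tendsto_ennrealI)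
  finally show ?thesis
    using mean_optimal_weakly_pathwise_optimal[OF assms(8,7)] by simp
qed

end
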